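(* Let $0<1/n\le1/d\ll\varepsilon,C\le1$ and suppose that $\lambda\le\varepsilon d$. Let $G$ be an $(n,d,\lambda)$-graph with $d\gg n^{2/3}\log n$, and let $H$ be the $K_3$-hypergraph of $G$. Then the following holds for any $p=p(n,d)\le C(n\log n)^{1/3}d^{-1}$. Let $a<\frac{1}{2^{10}}$ be a (positive) constant, and let $\pi=\pi(n,d)=ap^3$. Then $G\cap G(n,p)$ can be coupled with the random hypergraph $H\cap H_3(n,\pi)$ so that, with high probability, for every hyperedge in $H\cap H_3(n,\pi)$ there is a copy of $K_3$ in $G\cap G(n,p)$ with the same vertex set.
   Context: An $(n,d,\lambda)$-graph is an $n$-vertex $d$-regular graph whose second largest eigenvalue in absolute value is at most $\lambda$. The $K_3$-hypergraph $H$ of a graph $G$ is the $3$-uniform hypergraph with $V(H)=V(G)$ whose hyperedges are the vertex sets of all triangles of $G$. $G(n,p)$ is the binomial random graph on $V(G)$, so $G\cap G(n,p)$ is the random subgraph of $G$ keeping each edge independently with probability $p$. $H_3(n,\pi)$ is the binomial random $3$-uniform hypergraph on $V(G)$, so $H\cap H_3(n,\pi)$ is the random subhypergraph of $H$ keeping each hyperedge independently with probability $\pi$. A coupling is a joint distribution with the given marginals. "With high probability" means with probability tending to $1$ as $n\to\infty$. The hierarchy $1/d\ll\varepsilon,C$ means that $d$ is sufficiently large in terms of $\varepsilon$ and $C$; for functions of $n$, $f\gg g$ means $g/f\to0$ as $n\to\infty$. $\log$ is the natural logarithm. *)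

theory Defs
  imports "HOL-Probability.Probability" "Jordan_Normal_Form.Char_Poly"
begin

text \<open>Graphs and hypergraphs on \<open>n\<close> vertices are labelled: the vertex set is \<open>{..<n}\<close>, and a
  (hyper)graph is given by its set of (hyper)edges.\<close>

type_synonym edge_set = "nat set set"

definition all_subsets :: "nat \<Rightarrow> nat \<Rightarrow> edge_set" where
  "all_subsets n r = {e. e \<subseteq> {..<n} \<and> card e = r}"

definition regular_graph :: "nat \<Rightarrow> nat \<Rightarrow> edge_set \<Rightarrow> bool" where
  "regular_graph n d E \<longleftrightarrow> E \<subseteq> all_subsets n 2 \<and> (\<forall>v<n. card {e \<in> E. v \<in> e} = d)"

definition adjacency_matrix :: "nat \<Rightarrow> edge_set \<Rightarrow> real mat" where
  "adjacency_matrix n E = mat n n (\<lambda>(i, j). if {i, j} \<in> E then 1 else 0)"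

text \<open>The matrix is real symmetric, so its characteristic polynomial splits over the reals and
  \<open>proots\<close> yields all \<open>n\<close> eigenvalues with multiplicity.\<close>

definition graph_eigenvalues :: "nat \<Rightarrow> edge_set \<Rightarrow> real multiset" where
  "graph_eigenvalues n E = proots (char_poly (adjacency_matrix n E))"

text \<open>The absolute values of the eigenvalues are listed in decreasing order, with multiplicity,
  and the entry after the first is taken; this is only meaningful for \<open>n \<ge> 2\<close>.\<close>

definition second_abs_eigenvalue :: "nat \<Rightarrow> edge_set \<Rightarrow> real" where
  "second_abs_eigenvalue n E =
     rev (sorted_list_of_multiset (image_mset abs (graph_eigenvalues n E))) ! 1"

definition ndl_graph :: "nat \<Rightarrow> nat \<Rightarrow> real \<Rightarrow> edge_set \<Rightarrow> bool" where
  "ndl_graph n d lam E \<longleftrightarrow> regular_graph n d E \<and> second_abs_eigenvalue n E \<le> lam"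

definition K3_hypergraph :: "edge_set \<Rightarrow> edge_set" where
  "K3_hypergraph E =
     {{u, v, w} | u v w. u \<noteq> v \<and> u \<noteq> w \<and> v \<noteq> w \<and> {u, v} \<in> E \<and> {u, w} \<in> E \<and> {v, w} \<in> E}"

definition binomial_subset :: "'a set \<Rightarrow> real \<Rightarrow> 'a set pmf" where
  "binomial_subset S p = map_pmf (\<lambda>f. {x \<in> S. f x}) (Pi_pmf S False (\<lambda>_. bernoulli_pmf p))"

definition binomial_graph :: "nat \<Rightarrow> real \<Rightarrow> edge_set pmf" where
  "binomial_graph n p = binomial_subset (all_subsets n 2) p"

definition binomial_hypergraph3 :: "nat \<Rightarrow> real \<Rightarrow> edge_set pmf" where
  "binomial_hypergraph3 n q = binomial_subset (all_subsets n 3) q"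

definition is_coupling :: "('a \<times> 'b) pmf \<Rightarrow> 'a pmf \<Rightarrow> 'b pmf \<Rightarrow> bool" where
  "is_coupling Q M N \<longleftrightarrow> map_pmf fst Q = M \<and> map_pmf snd Q = N"

end

theory Submission
  imports Defs "HOL-Real_Asymp.Real_Asymp"
begin

text \<open>
  Test the triangles of \<open>G\<close> one by one. A test of \<open>t\<close> answers yes if \<open>t\<close> is present in the random
  graph and an independent coin comes up; if \<open>t\<close> is present with conditional probability at least
  \<open>\<pi>\<close>, the bias of the coin can be tuned so that the answer is yes with probability exactly \<open>\<pi>\<close>, and
  the yes answers then form \<open>H \<inter> H\<^sub>3(n, \<pi>)\<close>. Let \<open>R\<close> be the set of edges of the yes triangles.
  By Harris' inequality the conditional probability is at least \<open>p\<^sup>3 / 2\<close> unless one of the sides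
  \<open>{x, y} \<notin> R\<close> of \<open>t\<close> lies in too many no triangles whose other two sides are nearly in \<open>R\<close>. Here
  \<open>d p\<^sup>2\<close> and \<open>p\<close> times the degrees of \<open>R\<close> tend to \<open>0\<close>, so what matters is that \<open>x\<close> and \<open>y\<close> have a
  bounded number of common neighbours in \<open>R\<close>. In a fixed order of testing this fails when \<open>d\<close> is
  close to \<open>n powr (2/3) * ln n\<close>. Therefore a triangle is tested at once, as urgent, when two of its
  vertices get a common neighbour in \<open>R\<close>. Between runs of urgent tests no untested triangle has such
  a pair. Each yes triangle makes about \<open>d\<^sup>2 (d p\<^sup>3)\<close> further triangles urgent, of which on average
  \<open>d\<^sup>3 p\<^sup>6 = o(1)\<close> are answered yes, so that a run contains \<open>O(ln n)\<close> yes triangles, of which only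
  boundedly many give a common neighbour to a given pair. All these counts are controlled
  simultaneously by an exponential supermartingale.
\<close>

section \<open>Weights of random subsets\<close>

definition bernoulli_weight :: "'a set \<Rightarrow> real \<Rightarrow> 'a set \<Rightarrow> real" where
  "bernoulli_weight X p E = (\<Prod>e\<in>X. if e \<in> E then p else 1 - p)"

lemma bernoulli_weight_nonneg:
  assumes "0 \<le> p" "p \<le> 1"
  shows "0 \<le> bernoulli_weight X p E"
  unfolding bernoulli_weight_def using assms by (intro prod_nonneg) auto

lemma sum_Pow_insert:
  fixes f :: "'a set \<Rightarrow> 'b::comm_monoid_add"
  assumes "finite X" "e \<notin> X"
  shows "sum f (Pow (insert e X)) = (\<Sum>E\<in>Pow X. f E + f (insert e E))"
proof -
  have inj: "inj_on (insert e) (Pow X)"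
    using assms(2) by (auto simp: inj_on_def)
  have "sum f (Pow (insert e X)) = sum f (Pow X) + sum f (insert e ` Pow X)"
    unfolding Pow_insert using assms by (intro sum.union_disjoint) auto
  then show ?thesis
    using inj by (simp add: sum.reindex sum.distrib)
qed

lemma bernoulli_weight_insert:
  assumes "finite X" "e \<notin> X" "E \<subseteq> X"
  shows "bernoulli_weight (insert e X) p E = (1 - p) * bernoulli_weight X p E"
    and "bernoulli_weight (insert e X) p (insert e E) = p * bernoulli_weight X p E"
proof -
  show "bernoulli_weight (insert e X) p E = (1 - p) * bernoulli_weight X p E"
    using assms by (auto simp: bernoulli_weight_def)
  have "(\<Prod>x\<in>X. if x = e \<or> x \<in> E then p else 1 - p) = (\<Prod>x\<in>X. if x \<in> E then p else 1 - p)"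
    using assms by (intro prod.cong) auto
  then show "bernoulli_weight (insert e X) p (insert e E) = p * bernoulli_weight X p E"
    using assms by (simp add: bernoulli_weight_def)
qed

lemma bernoulli_weight_total:
  assumes "finite X"
  shows "(\<Sum>E\<in>Pow X. bernoulli_weight X p E) = 1"
  using assms
proof (induction X)
  case empty
  then show ?case by (simp add: bernoulli_weight_def)
next
  case (insert e X)
  have "(\<Sum>E\<in>Pow (insert e X). bernoulli_weight (insert e X) p E)
      = (\<Sum>E\<in>Pow X. bernoulli_weight X p E)"
    unfolding sum_Pow_insert[OF insert.hyps]
    by (intro sum.cong refl) (auto simp: bernoulli_weight_insert[OF insert.hyps] algebra_simps)
  then show ?case using insert.IH by simp
qed

text \<open>Pair each set without \<open>e\<close> with the set obtained by adding \<open>e\<close>.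
  Their weights are in the ratio of \<open>1 - p\<close> to \<open>p\<close>, and on the larger set
  \<open>f\<close> is at most its average over the pair. Monotonicity enters in the coordinate
  \<open>e\<close> only, and \<open>f\<close> may have any sign.\<close>

lemma harris_single:
  fixes f :: "'a set \<Rightarrow> real"
  assumes "finite X" "e \<in> X" "0 \<le> p" "p \<le> 1"
    and dec: "\<And>E. E \<subseteq> X \<Longrightarrow> e \<notin> E \<Longrightarrow> f (insert e E) \<le> f E"
  shows "(\<Sum>E\<in>Pow X. if e \<in> E then bernoulli_weight X p E * f E else 0)
    \<le> p * (\<Sum>E\<in>Pow X. bernoulli_weight X p E * f E)"
proof -
  define X' where "X' = X - {e}"
  have X: "X = insert e X'" and X': "finite X'" "e \<notin> X'"
    using assms by (auto simp: X'_def)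
  have "(\<Sum>E\<in>Pow X. if e \<in> E then bernoulli_weight X p E * f E else 0)
      = (\<Sum>E\<in>Pow X'. p * bernoulli_weight X' p E * f (insert e E))"
    unfolding X sum_Pow_insert[OF X']
    using X' by (intro sum.cong refl) (auto simp: bernoulli_weight_insert)
  also have "\<dots> \<le> (\<Sum>E\<in>Pow X'. p * ((1 - p) * bernoulli_weight X' p E * f E
      + p * bernoulli_weight X' p E * f (insert e E)))"
  proof (intro sum_mono)
    fix E assume "E \<in> Pow X'"
    then have "f (insert e E) \<le> f E" using X' X by (intro dec) auto
    then have "p * (1 - p) * bernoulli_weight X' p E * f (insert e E)
        \<le> p * (1 - p) * bernoulli_weight X' p E * f E"
      using assms(3,4) bernoulli_weight_nonneg[of p X' E] by (intro mult_left_mono) auto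
    then show "p * bernoulli_weight X' p E * f (insert e E)
        \<le> p * ((1 - p) * bernoulli_weight X' p E * f E
          + p * bernoulli_weight X' p E * f (insert e E))"
      by (simp add: algebra_simps)
  qed
  also have "\<dots> = p * (\<Sum>E\<in>Pow X. bernoulli_weight X p E * f E)"
    unfolding X sum_Pow_insert[OF X'] sum_distrib_left
    using X' by (intro sum.cong refl) (auto simp: bernoulli_weight_insert algebra_simps)
  finally show ?thesis .
qed

text \<open>The expectation of \<open>g\<close> on the event that the random set contains
  \<open>A\<close>. It is left unnormalised, so that conditioning on revealed edges never divides by
  a weight that may vanish.\<close>

definition up_mass :: "'a set \<Rightarrow> real \<Rightarrow> 'a set \<Rightarrow> ('a set \<Rightarrow> real) \<Rightarrow> real" where
  "up_mass X p A g = (\<Sum>E\<in>Pow X. if A \<subseteq> E then bernoulli_weight X p E * g E else 0)"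

lemma up_mass_insert_le:
  assumes "finite X" "e \<in> X" "0 \<le> p" "p \<le> 1" "e \<notin> A"
    and dec: "\<And>E. E \<subseteq> X \<Longrightarrow> e \<notin> E \<Longrightarrow> g (insert e E) \<le> g E"
  shows "up_mass X p (insert e A) g \<le> p * up_mass X p A g"
proof -
  let ?f = "\<lambda>E. if A \<subseteq> E then g E else 0"
  have "(\<Sum>E\<in>Pow X. if e \<in> E then bernoulli_weight X p E * ?f E else 0)
      \<le> p * (\<Sum>E\<in>Pow X. bernoulli_weight X p E * ?f E)"
    using assms by (intro harris_single) (auto simp: subset_insert)
  moreover have "up_mass X p (insert e A) g
      = (\<Sum>E\<in>Pow X. if e \<in> E then bernoulli_weight X p E * ?f E else 0)"
    unfolding up_mass_def by (intro sum.cong) auto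
  moreover have "up_mass X p A g = (\<Sum>E\<in>Pow X. bernoulli_weight X p E * ?f E)"
    unfolding up_mass_def by (intro sum.cong) auto
  ultimately show ?thesis by simp
qed

text \<open>The coordinates of \<open>S\<close> are added one at a time. The condition
  \<open>A \<subseteq> E\<close> inside \<open>up_mass\<close> is itself increasing in the
  coordinates of \<open>A\<close>, hence the disjointness of \<open>S\<close> and
  \<open>A\<close>.\<close>

lemma up_mass_union_le:
  assumes "finite X" "S \<subseteq> X" "0 \<le> p" "p \<le> 1" "S \<inter> A = {}"
    and dec: "\<And>E e. E \<subseteq> X \<Longrightarrow> e \<in> S \<Longrightarrow> e \<notin> E \<Longrightarrow> g (insert e E) \<le> g E"
  shows "up_mass X p (A \<union> S) g \<le> p ^ card S * up_mass X p A g"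
proof -
  have "finite S" using assms finite_subset by blast
  then show ?thesis using assms(2,5,6)
  proof (induction S)
    case empty
    then show ?case by simp
  next
    case (insert e S)
    have "up_mass X p (insert e (A \<union> S)) g \<le> p * up_mass X p (A \<union> S) g"
      using assms insert.prems insert.hyps by (intro up_mass_insert_le) auto
    also have "\<dots> \<le> p * (p ^ card S * up_mass X p A g)"
      using insert.prems assms(3) by (intro mult_left_mono insert.IH) auto
    finally show ?case using insert.hyps by (simp add: algebra_simps)
  qed
qed

text \<open>Harris' inequality applied to both \<open>g\<close> and its negative, which are
  decreasing in the coordinates of \<open>S\<close>.\<close>

lemma up_mass_union_eq:
  assumes "finite X" "S \<subseteq> X" "0 \<le> p" "p \<le> 1" "S \<inter> A = {}"
    and ind: "\<And>E e. E \<subseteq> X \<Longrightarrow> e \<in> S \<Longrightarrow> e \<notin> E \<Longrightarrow> g (insert e E) = g E"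
  shows "up_mass X p (A \<union> S) g = p ^ card S * up_mass X p A g"
proof (rule antisym)
  show "up_mass X p (A \<union> S) g \<le> p ^ card S * up_mass X p A g"
    using assms by (intro up_mass_union_le) auto
  have neg: "up_mass X p D (\<lambda>E. - g E) = - up_mass X p D g" for D
    unfolding up_mass_def sum_negf[symmetric] by (intro sum.cong) auto
  have "up_mass X p (A \<union> S) (\<lambda>E. - g E) \<le> p ^ card S * up_mass X p A (\<lambda>E. - g E)"
    using assms by (intro up_mass_union_le) auto
  then show "p ^ card S * up_mass X p A g \<le> up_mass X p (A \<union> S) g"
    by (simp add: neg)
qed

lemma up_mass_mono:
  assumes "0 \<le> p" "p \<le> 1" "\<And>E. E \<subseteq> X \<Longrightarrow> A \<subseteq> E \<Longrightarrow> g E \<le> g' E"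
  shows "up_mass X p A g \<le> up_mass X p A g'"
  unfolding up_mass_def using assms
  by (intro sum_mono) (auto intro!: mult_left_mono bernoulli_weight_nonneg)

lemma up_mass_nonneg:
  assumes "0 \<le> p" "p \<le> 1" "\<And>E. E \<subseteq> X \<Longrightarrow> A \<subseteq> E \<Longrightarrow> 0 \<le> g E"
  shows "0 \<le> up_mass X p A g"
  unfolding up_mass_def using assms
  by (intro sum_nonneg) (auto intro!: mult_nonneg_nonneg bernoulli_weight_nonneg)

lemma up_mass_diff:
  "up_mass X p A g - up_mass X p A g' = up_mass X p A (\<lambda>E. g E - g' E)"
  unfolding up_mass_def sum_subtractf[symmetric] by (intro sum.cong) (auto simp: algebra_simps)

text \<open>Given the random set \<open>E\<close>, the probability that every test in
  \<open>N\<close> is answered no, where a yes for \<open>s\<close> needs both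
  \<open>\<sigma> s \<subseteq> E\<close> and an independent coin of bias
  \<open>\<theta> s\<close>.\<close>

definition thin_weight :: "('t \<Rightarrow> 'a set) \<Rightarrow> ('t \<Rightarrow> real) \<Rightarrow> 't set \<Rightarrow> 'a set \<Rightarrow> real" where
  "thin_weight \<sigma> \<theta> N E = (\<Prod>s\<in>N. if \<sigma> s \<subseteq> E then 1 - \<theta> s else 1)"

lemma thin_weight_bounds:
  assumes "\<And>s. s \<in> N \<Longrightarrow> 0 \<le> \<theta> s \<and> \<theta> s \<le> 1"
  shows "0 \<le> thin_weight \<sigma> \<theta> N E" "thin_weight \<sigma> \<theta> N E \<le> 1"
  unfolding thin_weight_def using assms by (auto intro!: prod_nonneg prod_le_1)

lemma thin_weight_antimono:
  assumes "\<And>s. s \<in> N \<Longrightarrow> 0 \<le> \<theta> s \<and> \<theta> s \<le> 1" "E \<subseteq> E'"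
  shows "thin_weight \<sigma> \<theta> N E' \<le> thin_weight \<sigma> \<theta> N E"
  unfolding thin_weight_def using assms by (intro prod_mono) auto

text \<open>The Weierstrass product inequality, which acts as the union bound over the coins that
  may come up.\<close>

lemma one_minus_sum_le_prod:
  fixes y :: "'t \<Rightarrow> real"
  assumes "finite N" "\<And>s. s \<in> N \<Longrightarrow> 0 \<le> y s \<and> y s \<le> 1"
  shows "1 - sum y N \<le> (\<Prod>s\<in>N. 1 - y s)"
  using assms
proof (induction N)
  case empty
  then show ?case by simp
next
  case (insert s N)
  have "(\<Prod>s\<in>N. 1 - y s) \<le> 1" "0 \<le> (\<Prod>s\<in>N. 1 - y s)"
    using insert.prems by (auto intro!: prod_le_1 prod_nonneg)
  moreover have "1 - sum y N \<le> (\<Prod>s\<in>N. 1 - y s)" using insert by simp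
  moreover have "0 \<le> y s" using insert.prems by simp
  moreover from calculation have "y s * (\<Prod>s\<in>N. 1 - y s) \<le> y s" by (simp add: mult_left_le)
  ultimately show ?case using insert.hyps by (simp add: algebra_simps)
qed

text \<open>Absences that avoid \<open>B\<close> are independent of it; the others cost a union bound, each term of
  which is estimated by Harris' inequality.\<close>

lemma up_mass_thin_lower:
  assumes X: "finite X" and p: "0 \<le> p" "p \<le> 1" and N: "finite N"
    and th: "\<And>s. s \<in> N \<Longrightarrow> 0 \<le> \<theta> s \<and> \<theta> s \<le> 1"
    and sub: "\<And>s. s \<in> N \<Longrightarrow> \<sigma> s \<subseteq> X" and B: "B \<subseteq> X" "R \<inter> B = {}"
    and small: "(\<Sum>s\<in>{s\<in>N. \<sigma> s \<inter> B \<noteq> {}}. \<theta> s * p ^ card (\<sigma> s - (R \<union> B))) \<le> 1 / 2"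
  shows "p ^ card B / 2 * up_mass X p R (thin_weight \<sigma> \<theta> N)
    \<le> up_mass X p (R \<union> B) (thin_weight \<sigma> \<theta> N)"
proof -
  define N1 where "N1 = {s\<in>N. \<sigma> s \<inter> B \<noteq> {}}"
  define N0 where "N0 = {s\<in>N. \<sigma> s \<inter> B = {}}"
  let ?g = "thin_weight \<sigma> \<theta> N0"
  have NN: "N = N0 \<union> N1" "N0 \<inter> N1 = {}" "finite N0" "finite N1"
    using N by (auto simp: N0_def N1_def)
  have th0: "\<And>s. s \<in> N0 \<Longrightarrow> 0 \<le> \<theta> s \<and> \<theta> s \<le> 1" and th1: "\<And>s. s \<in> N1 \<Longrightarrow> 0 \<le> \<theta> s \<and> \<theta> s \<le> 1"
    using th NN by auto
  have split: "thin_weight \<sigma> \<theta> N E = ?g E * thin_weight \<sigma> \<theta> N1 E" for E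
    unfolding thin_weight_def NN(1) using NN by (intro prod.union_disjoint) auto
  define M where "M = up_mass X p (R \<union> B) ?g"
  have M0: "M \<ge> 0" unfolding M_def using p thin_weight_bounds[OF th0] by (intro up_mass_nonneg) auto
  \<comment> \<open>Forgetting the absences in \<open>N1\<close> can only increase the mass, and
    \<open>?g\<close> ignores the coordinates of \<open>B\<close>. So \<open>M\<close> dominates
    \<open>p ^ card B\<close> times the mass to be compared with.\<close>
  have "up_mass X p R (thin_weight \<sigma> \<theta> N) \<le> up_mass X p R ?g"
    using p thin_weight_bounds(2)[of N1 \<theta> \<sigma>, OF th1] thin_weight_bounds(1)[of N0 \<theta> \<sigma>, OF th0]
    by (intro up_mass_mono) (auto simp: split mult_left_le)
  moreover have "?g (insert e E) = ?g E" if "e \<in> B" for e E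
    unfolding thin_weight_def using that
    by (intro prod.cong refl) (auto simp: N0_def)
  then have "M = p ^ card B * up_mass X p R ?g"
    unfolding M_def using assms by (intro up_mass_union_eq) auto
  ultimately have upper: "p ^ card B * up_mass X p R (thin_weight \<sigma> \<theta> N) \<le> M"
    using p by (simp add: mult_left_mono)
  have "M - (\<Sum>s\<in>N1. \<theta> s * up_mass X p (R \<union> B \<union> (\<sigma> s - (R \<union> B))) ?g)
      = up_mass X p (R \<union> B) (\<lambda>E. ?g E * (1 - (\<Sum>s\<in>N1. if \<sigma> s \<subseteq> E then \<theta> s else 0)))"
  proof -
    have "(\<Sum>s\<in>N1. \<theta> s * up_mass X p (R \<union> B \<union> (\<sigma> s - (R \<union> B))) ?g)
       = (\<Sum>E\<in>Pow X. \<Sum>s\<in>N1. \<theta> s * (if R \<union> B \<union> (\<sigma> s - (R \<union> B)) \<subseteq> E then bernoulli_weight X p E * ?g E else 0))"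
      unfolding up_mass_def sum_distrib_left by (rule sum.swap)
    also have "\<dots> = up_mass X p (R \<union> B) (\<lambda>E. ?g E * (\<Sum>s\<in>N1. if \<sigma> s \<subseteq> E then \<theta> s else 0))"
      unfolding up_mass_def
    proof (intro sum.cong refl)
      fix E
      show "(\<Sum>s\<in>N1. \<theta> s * (if R \<union> B \<union> (\<sigma> s - (R \<union> B)) \<subseteq> E then bernoulli_weight X p E * ?g E else 0))
        = (if R \<union> B \<subseteq> E then bernoulli_weight X p E * (?g E * (\<Sum>s\<in>N1. if \<sigma> s \<subseteq> E then \<theta> s else 0)) else 0)"
        unfolding sum_distrib_left by (cases "R \<union> B \<subseteq> E") (auto intro!: sum.cong sum.neutral)
    qed
    finally show ?thesis
      unfolding M_def by (simp add: up_mass_diff right_diff_distrib)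
  qed
  also have "\<dots> \<le> up_mass X p (R \<union> B) (thin_weight \<sigma> \<theta> N)"
  proof (intro up_mass_mono p)
    fix E
    have "1 - (\<Sum>s\<in>N1. if \<sigma> s \<subseteq> E then \<theta> s else 0) \<le> (\<Prod>s\<in>N1. 1 - (if \<sigma> s \<subseteq> E then \<theta> s else 0))"
      using th1 NN by (intro one_minus_sum_le_prod) auto
    also have "\<dots> = thin_weight \<sigma> \<theta> N1 E"
      unfolding thin_weight_def by (intro prod.cong) auto
    finally show "?g E * (1 - (\<Sum>s\<in>N1. if \<sigma> s \<subseteq> E then \<theta> s else 0)) \<le> thin_weight \<sigma> \<theta> N E"
      unfolding split using thin_weight_bounds(1)[OF th0] by (intro mult_left_mono) auto
  qed
  finally have lower: "M - (\<Sum>s\<in>N1. \<theta> s * up_mass X p (R \<union> B \<union> (\<sigma> s - (R \<union> B))) ?g)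
      \<le> up_mass X p (R \<union> B) (thin_weight \<sigma> \<theta> N)" .
  \<comment> \<open>Given \<open>R \<union> B\<close>, a yes for \<open>s\<close> needs the
    remaining elements of \<open>\<sigma> s\<close>. As \<open>?g\<close> is decreasing in every
    coordinate, each of them costs at least a factor \<open>p\<close>.\<close>
  have "(\<Sum>s\<in>N1. \<theta> s * up_mass X p (R \<union> B \<union> (\<sigma> s - (R \<union> B))) ?g)
      \<le> (\<Sum>s\<in>N1. \<theta> s * (p ^ card (\<sigma> s - (R \<union> B)) * M))"
    unfolding M_def using th1 sub NN X p
    by (intro sum_mono mult_left_mono up_mass_union_le thin_weight_antimono[OF th0]) auto
  also have "\<dots> = (\<Sum>s\<in>N1. \<theta> s * p ^ card (\<sigma> s - (R \<union> B))) * M"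
    unfolding sum_distrib_right by (simp add: mult.assoc)
  also have "\<dots> \<le> 1 / 2 * M"
    using small M0 by (intro mult_right_mono) (auto simp: N1_def)
  finally show ?thesis using lower upper by simp
qed

section \<open>Coupling along an exploration\<close>

text \<open>Histories list the tested elements, newest first, with the outcome of each test.\<close>

type_synonym 't history = "('t \<times> bool) list"

definition tested :: "'t history \<Rightarrow> 't set" where
  "tested h = fst ` set h"

definition yes :: "'t history \<Rightarrow> 't set" where
  "yes h = {t. (t, True) \<in> set h}"

definition no :: "'t history \<Rightarrow> 't set" where
  "no h = {t. (t, False) \<in> set h}"

lemma tested_simps [simp]: "tested [] = {}" "tested ((t, b) # h) = insert t (tested h)"
  by (auto simp: tested_def)

lemma yes_simps [simp]: "yes [] = {}" "yes ((t, True) # h) = insert t (yes h)"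
    "yes ((t, False) # h) = yes h"
  by (auto simp: yes_def)

lemma no_simps [simp]: "no [] = {}" "no ((t, True) # h) = no h"
    "no ((t, False) # h) = insert t (no h)"
  by (auto simp: no_def)

lemma tested_eq: "tested h = yes h \<union> no h"
  by (induction h) (auto simp: tested_def yes_def no_def image_iff)

lemma finite_history [simp]: "finite (tested h)" "finite (yes h)" "finite (no h)"
proof -
  show "finite (tested h)" by (simp add: tested_def)
  then show "finite (yes h)" "finite (no h)" by (auto simp: tested_eq)
qed

lemma yes_no_disjoint: "distinct (map fst h) \<Longrightarrow> yes h \<inter> no h = {}"
  by (auto simp: yes_def no_def dest: eq_key_imp_eq_value)

text \<open>The conditional law, given the answers in \<open>h\<close>, of the random subset of
  \<open>T\<close> that keeps each element with probability \<open>\<pi>\<close>: tested elements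
  are frozen, the others are still independent.\<close>

definition hist_mass :: "'t set \<Rightarrow> real \<Rightarrow> 't history \<Rightarrow> 't set \<Rightarrow> real" where
  "hist_mass T \<pi> h F = (if yes h \<subseteq> F \<and> F \<inter> no h = {}
     then bernoulli_weight (T - tested h) \<pi> F else 0)"

lemma hist_mass_nonneg: "0 \<le> \<pi> \<Longrightarrow> \<pi> \<le> 1 \<Longrightarrow> 0 \<le> hist_mass T \<pi> h F"
  by (simp add: hist_mass_def bernoulli_weight_nonneg)

lemma hist_mass_step:
  assumes "finite T" "t \<in> T - tested h"
  shows "hist_mass T \<pi> h F =
    \<pi> * hist_mass T \<pi> ((t, True) # h) F + (1 - \<pi>) * hist_mass T \<pi> ((t, False) # h) F"
proof -
  have "T - tested h - {t} = T - insert t (tested h)" by auto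
  then have "bernoulli_weight (T - tested h) \<pi> F
      = (if t \<in> F then \<pi> else 1 - \<pi>) * bernoulli_weight (T - insert t (tested h)) \<pi> F"
    unfolding bernoulli_weight_def
    using assms prod.remove[of "T - tested h" t "\<lambda>e. if e \<in> F then \<pi> else 1 - \<pi>"] by simp
  then show ?thesis by (auto simp: hist_mass_def)
qed

lemma hist_mass_complete:
  assumes "tested h = T" "F \<subseteq> T" "distinct (map fst h)"
  shows "hist_mass T \<pi> h F = (if F = yes h then 1 else 0)"
  using assms yes_no_disjoint[of h] tested_eq[of h]
  by (auto simp: hist_mass_def bernoulli_weight_def)

lemma hist_mass_total:
  assumes "finite T" "tested h \<subseteq> T" "distinct (map fst h)"
  shows "(\<Sum>F\<in>Pow T. hist_mass T \<pi> h F) = 1"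
  using assms
proof (induction "card (T - tested h)" arbitrary: h)
  case 0
  then have "tested h = T" by auto
  moreover have "yes h \<in> Pow T" using \<open>tested h = T\<close> tested_eq[of h] by auto
  ultimately show ?case
    using 0 by (simp add: hist_mass_complete sum.delta)
next
  case (Suc k)
  then have "T - tested h \<noteq> {}" by (metis card.empty nat.simps(3))
  then obtain t where t: "t \<in> T - tested h" by blast
  have "(\<Sum>F\<in>Pow T. hist_mass T \<pi> ((t, b) # h) F) = 1" for b
  proof (rule Suc.hyps(1))
    have "T - tested ((t, b) # h) = (T - tested h) - {t}" by auto
    then show "k = card (T - tested ((t, b) # h))"
      using Suc.hyps(2) t Suc.prems by simp
    show "distinct (map fst ((t, b) # h))" using Suc.prems t by (simp add: tested_def)
  qed (use Suc.prems t in auto)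
  then show ?case
    by (simp add: hist_mass_step[OF Suc.prems(1) t] sum.distrib sum_distrib_left[symmetric])
qed

definition revealed :: "('t \<Rightarrow> 'a set) \<Rightarrow> 't history \<Rightarrow> 'a set" where
  "revealed \<sigma> h = (\<Union>t\<in>yes h. \<sigma> t)"

lemma revealed_simps [simp]: "revealed \<sigma> [] = {}"
    "revealed \<sigma> ((t, True) # h) = revealed \<sigma> h \<union> \<sigma> t"
    "revealed \<sigma> ((t, False) # h) = revealed \<sigma> h"
  by (auto simp: revealed_def)

text \<open>The joint weight of the edge set \<open>E\<close> and the history \<open>h\<close>. The
  number \<open>\<kappa>\<close> collects the coin biases of the positive tests, which moreover
  force \<open>revealed \<sigma> h \<subseteq> E\<close>; the factor \<open>thin_weight\<close>
  accounts for the negative tests.\<close>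

definition posterior ::
  "'a set \<Rightarrow> real \<Rightarrow> ('t \<Rightarrow> 'a set) \<Rightarrow> real \<Rightarrow> ('t \<Rightarrow> real) \<Rightarrow> 't history \<Rightarrow> 'a set \<Rightarrow> real" where
  "posterior X p \<sigma> \<kappa> \<theta> h E = (if revealed \<sigma> h \<subseteq> E
     then \<kappa> * (bernoulli_weight X p E * thin_weight \<sigma> \<theta> (no h) E) else 0)"

lemma posterior_up_mass:
  "(\<Sum>E\<in>Pow X. posterior X p \<sigma> \<kappa> \<theta> h E) = \<kappa> * up_mass X p (revealed \<sigma> h) (thin_weight \<sigma> \<theta> (no h))"
  unfolding up_mass_def posterior_def sum_distrib_left by (intro sum.cong) auto

definition defect :: "'a set \<Rightarrow> 't set \<Rightarrow> ('t \<Rightarrow> 'a set) \<Rightarrow> ('a set \<Rightarrow> 't set \<Rightarrow> real) \<Rightarrow> real" where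
  "defect X T \<sigma> c = (\<Sum>E\<in>Pow X. \<Sum>F\<in>Pow T. if \<forall>t\<in>F. \<sigma> t \<subseteq> E then 0 else c E F)"

text \<open>Here \<open>v\<close> is meant to have total mass 1 while \<open>w\<close> is
  unnormalised, hence the factor in the second marginal. In this form the couplings that follow the
  two answers to a test add up to a coupling before the test.\<close>

definition mass_coupling ::
  "'a set \<Rightarrow> 't set \<Rightarrow> ('a set \<Rightarrow> real) \<Rightarrow> ('t set \<Rightarrow> real) \<Rightarrow> ('a set \<Rightarrow> 't set \<Rightarrow> real) \<Rightarrow> bool" where
  "mass_coupling X T w v c \<longleftrightarrow> (\<forall>E F. 0 \<le> c E F) \<and>
     (\<forall>E\<in>Pow X. (\<Sum>F\<in>Pow T. c E F) = w E) \<and>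
     (\<forall>F\<in>Pow T. (\<Sum>E\<in>Pow X. c E F) = sum w (Pow X) * v F)"

lemma mass_coupling_product:
  assumes "\<And>E. 0 \<le> w E" "\<And>F. 0 \<le> v F" "sum v (Pow T) = 1"
  shows "mass_coupling X T w v (\<lambda>E F. w E * v F)"
  using assms unfolding mass_coupling_def
  by (auto simp flip: sum_distrib_left sum_distrib_right)

lemma defect_le_mass:
  assumes "mass_coupling X T w v c"
  shows "defect X T \<sigma> c \<le> sum w (Pow X)"
proof -
  have "defect X T \<sigma> c \<le> (\<Sum>E\<in>Pow X. \<Sum>F\<in>Pow T. c E F)"
    unfolding defect_def using assms by (intro sum_mono) (auto simp: mass_coupling_def)
  also have "\<dots> = sum w (Pow X)"
    using assms by (intro sum.cong) (auto simp: mass_coupling_def)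
  finally show ?thesis .
qed

text \<open>Here \<open>\<theta> t\<close> is the bias of the coin in a negative test of \<open>t\<close>, and \<open>m\<close> bounds it. Once
  \<open>\<Psi> \<ge> 1\<close> the rest is coupled independently.\<close>

lemma exploration_coupling:
  fixes \<Psi> :: "'t history \<Rightarrow> real" and \<sigma> :: "'t \<Rightarrow> 'a set"
  assumes fin: "finite T" "finite X" and p: "0 \<le> p" "p \<le> 1" and \<pi>: "0 \<le> \<pi>" "\<pi> \<le> 1"
    and m: "0 \<le> m" "m \<le> 1"
    and V_sub: "\<And>h. V h \<Longrightarrow> tested h \<subseteq> T \<and> distinct (map fst h)"
    and V_step: "\<And>h b. V h \<Longrightarrow> tested h \<noteq> T \<Longrightarrow> ntest h \<in> T - tested h \<and> V ((ntest h, b) # h)"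
    and \<Psi>_nonneg: "\<And>h. V h \<Longrightarrow> 0 \<le> \<Psi> h"
    and \<Psi>_step: "\<And>h. V h \<Longrightarrow> tested h \<noteq> T \<Longrightarrow> \<Psi> h < 1 \<Longrightarrow>
        \<pi> * \<Psi> ((ntest h, True) # h) + (1 - \<pi>) * \<Psi> ((ntest h, False) # h) \<le> \<Psi> h"
    and rate: "\<And>h \<theta>. V h \<Longrightarrow> tested h \<noteq> T \<Longrightarrow> \<Psi> h < 1 \<Longrightarrow> (\<And>s. 0 \<le> \<theta> s \<and> \<theta> s \<le> m) \<Longrightarrow>
        \<pi> * up_mass X p (revealed \<sigma> h) (thin_weight \<sigma> \<theta> (no h))
        \<le> m * up_mass X p (revealed \<sigma> h \<union> \<sigma> (ntest h)) (thin_weight \<sigma> \<theta> (no h))"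
    and h: "V h" and \<kappa>: "0 \<le> \<kappa>" and \<theta>: "\<And>s. 0 \<le> \<theta> s \<and> \<theta> s \<le> m"
  shows "\<exists>c. mass_coupling X T (posterior X p \<sigma> \<kappa> \<theta> h) (hist_mass T \<pi> h) c \<and>
    defect X T \<sigma> c \<le> sum (posterior X p \<sigma> \<kappa> \<theta> h) (Pow X) * \<Psi> h"
  using h \<kappa> \<theta>
\<comment> \<open>The bias of a coin is determined only when its test is reached, so
  \<open>\<kappa>\<close> and \<open>\<theta>\<close> vary in the induction: a yes multiplies
  \<open>\<kappa>\<close> by the bias, a no stores the bias in \<open>\<theta>\<close>.\<close>
proof (induction "card (T - tested h)" arbitrary: h \<kappa> \<theta> rule: less_induct)
  case (less h \<kappa> \<theta>)
  let ?w = "posterior X p \<sigma> \<kappa> \<theta> h" and ?v = "hist_mass T \<pi> h"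
  let ?W = "sum ?w (Pow X)"
  have th1: "0 \<le> \<theta> s \<and> \<theta> s \<le> 1" for s using less.prems(3)[of s] m by auto
  have w0: "0 \<le> ?w E" for E
    using less.prems(2) p thin_weight_bounds(1)[of "no h" \<theta> \<sigma>, OF th1]
    by (simp add: posterior_def bernoulli_weight_nonneg)
  then have W0: "0 \<le> ?W" by (intro sum_nonneg) auto
  note Vh = V_sub[OF less.prems(1)]
  have v0: "0 \<le> ?v F" for F using \<pi> by (simp add: hist_mass_nonneg)
  have v1: "sum ?v (Pow T) = 1" using fin Vh by (intro hist_mass_total) auto
  have indep: "mass_coupling X T ?w ?v (\<lambda>E F. ?w E * ?v F)"
    using w0 v0 v1 by (rule mass_coupling_product)
  consider "tested h = T" | "1 \<le> \<Psi> h" | "tested h \<noteq> T" "\<Psi> h < 1" by linarith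
  then show ?case
  proof cases
    case 1
    let ?c = "\<lambda>E F. ?w E * ?v F"
    \<comment> \<open>All of \<open>T\<close> has been tested, so \<open>F\<close> must be the set
      of yes elements, and the posterior vanishes unless \<open>E\<close> contains everything they
      reveal.\<close>
    have "defect X T \<sigma> ?c = 0"
      unfolding defect_def
    proof (intro sum.neutral ballI)
      fix E F assume "E \<in> Pow X" "F \<in> Pow T"
      then show "(if \<forall>t\<in>F. \<sigma> t \<subseteq> E then 0 else ?c E F) = 0"
        using hist_mass_complete[OF 1, of F \<pi>] Vh
        by (simp add: posterior_def revealed_def) blast
    qed
    then show ?thesis
      using indep mult_nonneg_nonneg[OF W0 \<Psi>_nonneg[OF less.prems(1)]]
      by (intro exI[of _ ?c] conjI) (assumption, simp only:)
  next
    case 2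
    then have "?W \<le> ?W * \<Psi> h" using mult_left_mono[OF 2 W0] by simp
    with defect_le_mass[OF indep, of \<sigma>]
    have "defect X T \<sigma> (\<lambda>E F. ?w E * ?v F) \<le> ?W * \<Psi> h" by (rule order_trans)
    with indep show ?thesis by - (rule exI[of _ "\<lambda>E F. ?w E * ?v F"], rule conjI)
  next
    case 3
    define t where "t = ntest h"
    have t: "t \<in> T - tested h" and Vt: "V ((t, b) # h)" for b
      using V_step[OF less.prems(1) 3(1)] by (auto simp: t_def)
    have tno: "t \<notin> no h" using t tested_eq[of h] by auto
    define A where "A = \<kappa> * up_mass X p (revealed \<sigma> h \<union> \<sigma> t) (thin_weight \<sigma> \<theta> (no h))"
    have A0: "0 \<le> A"
      unfolding A_def using less.prems(2) p thin_weight_bounds(1)[of "no h" \<theta> \<sigma>, OF th1]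
      by (intro mult_nonneg_nonneg up_mass_nonneg) auto
    have "\<kappa> * (\<pi> * up_mass X p (revealed \<sigma> h) (thin_weight \<sigma> \<theta> (no h)))
        \<le> \<kappa> * (m * up_mass X p (revealed \<sigma> h \<union> \<sigma> t) (thin_weight \<sigma> \<theta> (no h)))"
      unfolding t_def
      by (rule mult_left_mono[OF rate[OF less.prems(1) 3 less.prems(3)] less.prems(2)])
    then have WA: "\<pi> * ?W \<le> m * A"
      unfolding posterior_up_mass A_def by (simp add: algebra_simps)
    \<comment> \<open>The bias that gives the answer yes exactly the mass \<open>\<pi> * ?W\<close>.
      If \<open>A = 0\<close>, division by zero yields \<open>r = 0\<close>, and \<open>WA\<close>
      forces \<open>\<pi> * ?W = 0\<close>, so that the identity for \<open>r * A\<close>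
      survives.\<close>
    define r where "r = \<pi> * ?W / A"
    have r: "0 \<le> r" "r \<le> m" "r * A = \<pi> * ?W"
    proof -
      show "0 \<le> r" unfolding r_def using A0 W0 \<pi> by simp
      show "r \<le> m"
        using WA A0 m by (cases "A = 0") (auto simp: r_def divide_le_eq)
      have "0 \<le> \<pi> * ?W" using W0 \<pi> by simp
      then show "r * A = \<pi> * ?W"
        using antisym[OF _ \<open>0 \<le> \<pi> * ?W\<close>] WA by (cases "A = 0") (simp_all add: r_def)
    qed
    let ?wy = "posterior X p \<sigma> (\<kappa> * r) \<theta> ((t, True) # h)"
    let ?wn = "posterior X p \<sigma> \<kappa> (\<theta>(t := r)) ((t, False) # h)"
    have thin: "thin_weight \<sigma> (\<theta>(t := r)) (insert t (no h)) E
        = (if \<sigma> t \<subseteq> E then 1 - r else 1) * thin_weight \<sigma> \<theta> (no h) E" for E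
    proof -
      have "(\<Prod>s\<in>no h. if \<sigma> s \<subseteq> E then 1 - (\<theta>(t := r)) s else 1)
          = (\<Prod>s\<in>no h. if \<sigma> s \<subseteq> E then 1 - \<theta> s else 1)"
        using tno by (intro prod.cong) auto
      then show ?thesis unfolding thin_weight_def using tno by simp
    qed
    have wsplit: "?w E = ?wy E + ?wn E" for E
      by (auto simp: posterior_def thin algebra_simps)
    have Wy: "sum ?wy (Pow X) = \<pi> * ?W"
      unfolding posterior_up_mass[of X p \<sigma> "\<kappa> * r"] r(3)[symmetric] A_def by simp
    have Wn: "sum ?wn (Pow X) = (1 - \<pi>) * ?W"
    proof -
      have "?W = sum ?wy (Pow X) + sum ?wn (Pow X)"
        unfolding sum.distrib[symmetric] by (intro sum.cong refl wsplit)
      then show ?thesis using Wy by (simp only: left_diff_distrib)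
    qed
    have less_card: "card (T - tested ((t, b) # h)) < card (T - tested h)" for b
      using fin t by (intro psubset_card_mono) auto
    obtain cy where cy: "mass_coupling X T ?wy (hist_mass T \<pi> ((t, True) # h)) cy"
        "defect X T \<sigma> cy \<le> sum ?wy (Pow X) * \<Psi> ((t, True) # h)"
      using less.hyps[of "(t, True) # h" "\<kappa> * r" \<theta>, OF less_card Vt
          mult_nonneg_nonneg[OF less.prems(2) r(1)] less.prems(3)]
      by (elim exE conjE)
    have th': "0 \<le> (\<theta>(t := r)) s \<and> (\<theta>(t := r)) s \<le> m" for s
      using less.prems r by simp
    obtain cn where cn: "mass_coupling X T ?wn (hist_mass T \<pi> ((t, False) # h)) cn"
        "defect X T \<sigma> cn \<le> sum ?wn (Pow X) * \<Psi> ((t, False) # h)"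
      using less.hyps[of "(t, False) # h" \<kappa> "\<theta>(t := r)", OF less_card Vt less.prems(2) th']
      by (elim exE conjE)
    let ?c = "\<lambda>E F. cy E F + cn E F"
    have coupling: "mass_coupling X T ?w ?v ?c"
      unfolding mass_coupling_def
    proof (intro conjI allI ballI)
      show "0 \<le> ?c E F" for E F
        using cy(1) cn(1) by (simp add: mass_coupling_def)
      show "(\<Sum>F\<in>Pow T. ?c E F) = ?w E" if "E \<in> Pow X" for E
        using cy(1) cn(1) that unfolding mass_coupling_def wsplit sum.distrib by metis
      show "(\<Sum>E\<in>Pow X. ?c E F) = ?W * ?v F" if "F \<in> Pow T" for F
      proof -
        have "(\<Sum>E\<in>Pow X. ?c E F) = \<pi> * ?W * hist_mass T \<pi> ((t, True) # h) F
            + (1 - \<pi>) * ?W * hist_mass T \<pi> ((t, False) # h) F"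
          using cy(1) cn(1) that unfolding mass_coupling_def sum.distrib Wy Wn by metis
        then show ?thesis unfolding hist_mass_step[OF fin(1) t] by (simp add: algebra_simps)
      qed
    qed
    have "defect X T \<sigma> ?c = defect X T \<sigma> cy + defect X T \<sigma> cn"
      unfolding defect_def sum.distrib[symmetric] by (intro sum.cong) auto
    then have "defect X T \<sigma> ?c
        \<le> \<pi> * ?W * \<Psi> ((t, True) # h) + (1 - \<pi>) * ?W * \<Psi> ((t, False) # h)"
      using cy(2) cn(2) unfolding Wy Wn by linarith
    also have "\<dots> = ?W * (\<pi> * \<Psi> ((t, True) # h) + (1 - \<pi>) * \<Psi> ((t, False) # h))"
      by (simp only: algebra_simps)
    also have "\<dots> \<le> ?W * \<Psi> h"
      using mult_left_mono[OF \<Psi>_step[OF less.prems(1) 3] W0] unfolding t_def .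
    finally have "defect X T \<sigma> ?c \<le> ?W * \<Psi> h" .
    with coupling show ?thesis by - (rule exI[of _ ?c], rule conjI)
  qed
qed

section \<open>Urgent tests and runs\<close>

definition sides :: "nat set \<Rightarrow> edge_set" where
  "sides t = {e. e \<subseteq> t \<and> card e = 2}"

lemma pair_in_sides: "{x, y} \<in> sides t \<longleftrightarrow> x \<in> t \<and> y \<in> t \<and> x \<noteq> y"
  by (auto simp: sides_def card_insert_if)

lemma sides_pairE:
  assumes "e \<in> sides t"
  obtains x y where "e = {x, y}" "x \<in> t" "y \<in> t" "x \<noteq> y"
  using assms by (auto simp: sides_def card_2_iff)

lemma sides_triple: "sides {x, y, z} \<subseteq> {{x, y}, {x, z}, {y, z}}"
  by (auto elim!: sides_pairE)

lemma card_UN_le_mult: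
  assumes "finite I" "card I \<le> k" "\<And>i. i \<in> I \<Longrightarrow> card (A i) \<le> m"
  shows "card (\<Union>i\<in>I. A i) \<le> k * m"
proof -
  have "card (\<Union>i\<in>I. A i) \<le> (\<Sum>i\<in>I. card (A i))" by (rule card_UN_le[OF assms(1)])
  also have "\<dots> \<le> card I * m" using sum_bounded_above[of I "\<lambda>i. card (A i)" m] assms(3) by simp
  also have "\<dots> \<le> k * m" using assms(2) by (rule mult_le_mono1)
  finally show ?thesis .
qed

definition nbrs :: "edge_set \<Rightarrow> nat \<Rightarrow> nat set" where
  "nbrs R x = {y. {x, y} \<in> R}"

definition common_nbrs :: "edge_set \<Rightarrow> nat \<Rightarrow> nat \<Rightarrow> nat set" where
  "common_nbrs R x y = {c. {x, c} \<in> R \<and> {c, y} \<in> R}"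

definition urgent :: "edge_set \<Rightarrow> nat set \<Rightarrow> bool" where
  "urgent R t \<longleftrightarrow> (\<exists>v\<in>t. \<exists>b\<in>t. v \<noteq> b \<and> common_nbrs R v b \<noteq> {})"

lemma common_nbrs_mono: "R \<subseteq> R' \<Longrightarrow> common_nbrs R x y \<subseteq> common_nbrs R' x y"
  by (auto simp: common_nbrs_def)

text \<open>At least one of the two edges at a new common neighbour \<open>c\<close> is a side of
  \<open>t\<close>, which puts \<open>c\<close> and one of \<open>x\<close>, \<open>y\<close> into
  \<open>t\<close>. The other edge is a side as well or was present before. Since edges have two
  elements, \<open>c\<close> differs from \<open>x\<close> and \<open>y\<close>.\<close>

lemma common_nbrs_new:
  assumes "\<And>e. e \<in> R \<Longrightarrow> card e = 2" "c \<in> common_nbrs (R \<union> sides t) x y" "c \<notin> common_nbrs R x y"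
  shows "c \<in> t - {x, y}" "x \<in> t \<and> y \<in> t \<or> x \<in> t \<and> {c, y} \<in> R \<or> y \<in> t \<and> {c, x} \<in> R"
proof -
  have "card {x, c} = 2" "card {c, y} = 2"
    using assms by (auto simp: common_nbrs_def sides_def)
  then have ne: "c \<noteq> x" "c \<noteq> y" by auto
  have "{x, c} \<in> sides t \<or> {c, y} \<in> sides t" using assms by (auto simp: common_nbrs_def)
  then show "c \<in> t - {x, y}" using ne by (auto simp: pair_in_sides)
  show "x \<in> t \<and> y \<in> t \<or> x \<in> t \<and> {c, y} \<in> R \<or> y \<in> t \<and> {c, x} \<in> R"
    using assms by (auto simp: common_nbrs_def pair_in_sides insert_commute)
qed

text \<open>A run is a maximal block of consecutive tests of which only the first is not urgent.\<close>

abbreviation graph_of :: "nat set history \<Rightarrow> edge_set" where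
  "graph_of \<equiv> revealed sides"

fun run :: "nat set history \<Rightarrow> nat set history" where
  "run [] = []"
| "run ((t, b) # h) = (if urgent (graph_of h) t then (t, b) # run h else [(t, b)])"

fun run_start :: "nat set history \<Rightarrow> nat set" where
  "run_start [] = {}"
| "run_start ((t, b) # h) = (if urgent (graph_of h) t then run_start h else t)"

fun run_rest :: "nat set history \<Rightarrow> nat set set" where
  "run_rest [] = {}"
| "run_rest ((t, b) # h) = (if urgent (graph_of h) t then insert t (run_rest h) else {})"

abbreviation run_edges :: "nat set history \<Rightarrow> edge_set" where
  "run_edges h \<equiv> graph_of (run h)"

text \<open>Marks are evaluated before the outcome of the test is known, so the yes answers among the
  marked tests of a family are dominated by a binomial variable.\<close>

datatype family = Deg nat | Cod nat nat | Run "nat set" | Win "nat set" nat nat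

definition extends_nbrs :: "edge_set \<Rightarrow> nat \<Rightarrow> nat \<Rightarrow> nat set \<Rightarrow> bool" where
  "extends_nbrs R x y t \<longleftrightarrow> x \<noteq> y \<and> common_nbrs (R \<union> sides t) x y \<noteq> common_nbrs R x y"

text \<open>\<open>Deg\<close> and \<open>Cod\<close> control degrees and codegrees throughout,
  \<open>Run\<close> the length of a run, and \<open>Win\<close> the codegrees gained within one
  run. Runs are named by their first triangle, which makes the families a fixed finite set that does
  not depend on the random answers.\<close>

fun mark :: "family \<Rightarrow> nat set history \<Rightarrow> nat set \<Rightarrow> bool" where
  "mark (Deg x) h t \<longleftrightarrow> x \<in> t"
| "mark (Cod x y) h t \<longleftrightarrow> extends_nbrs (graph_of h) x y t"
| "mark (Run k) h t \<longleftrightarrow> urgent (graph_of h) t \<and> run_start h = k"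
| "mark (Win k x y) h t \<longleftrightarrow> urgent (graph_of h) t \<and> run_start h = k \<and>
    {x, y} \<notin> graph_of h \<and> extends_nbrs (graph_of h) x y t"

fun marked :: "family \<Rightarrow> nat set history \<Rightarrow> nat set set" where
  "marked i [] = {}"
| "marked i ((t, b) # h) = (if mark i h t then insert t (marked i h) else marked i h)"

fun hits :: "family \<Rightarrow> nat set history \<Rightarrow> nat set set" where
  "hits i [] = {}"
| "hits i ((t, b) # h) = (if b \<and> mark i h t then insert t (hits i h) else hits i h)"

lemma marked_subset: "marked i h \<subseteq> tested h" and hits_subset: "hits i h \<subseteq> yes h"
  by (induction i h rule: marked.induct) (auto simp: yes_def)

lemma finite_marked [simp]: "finite (marked i h)" and finite_hits [simp]: "finite (hits i h)"
  by (rule finite_subset[OF marked_subset], simp) (rule finite_subset[OF hits_subset], simp)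

lemma yes_Cons: "yes ((t, b) # h) = (if b then insert t (yes h) else yes h)"
  by (cases b) auto

lemma graph_of_Cons: "graph_of ((t, b) # h) = (if b then graph_of h \<union> sides t else graph_of h)"
  by (cases b) auto

lemma card_graph_of: "e \<in> graph_of h \<Longrightarrow> card e = 2"
  by (auto simp: revealed_def sides_def)

lemma yes_run_subset: "yes (run h) \<subseteq> yes h"
  by (induction h rule: run.induct) (auto simp: yes_Cons)

lemma run_edges_subset: "run_edges h \<subseteq> graph_of h"
  using yes_run_subset by (auto simp: revealed_def)

lemma not_urgent_empty [simp]: "\<not> urgent {} t"
  by (auto simp: urgent_def common_nbrs_def)

text \<open>The first test is never urgent, so the default \<open>{}\<close> of
  \<open>run_start []\<close> does not reach a nonempty history.\<close>

lemma run_start_tested: "h \<noteq> [] \<Longrightarrow> run_start h \<in> tested h"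
proof (induction h rule: run_start.induct)
  case (2 t b h)
  then show ?case by (cases "h = []") auto
qed simp

lemma mark_Run_tested: "mark (Run k) h t \<Longrightarrow> k \<in> tested h"
  using run_start_tested[of h] by (cases h) auto

lemma marked_Win_subset: "marked (Win k x y) h \<subseteq> marked (Run k) h"
  by (induction "Win k x y" h rule: marked.induct) auto

text \<open>A run collects marks only after its first triangle has been tested; hence a run that
  starts now has none yet.\<close>

lemma marked_Run_untested: "k \<notin> tested h \<Longrightarrow> marked (Run k) h = {}"
  by (induction "Run k" h rule: marked.induct) (auto simp del: mark.simps dest: mark_Run_tested)

lemma hits_Deg: "hits (Deg x) h = {k \<in> yes h. x \<in> k}"
  by (induction "Deg x" h rule: hits.induct) (auto simp: yes_Cons)

lemma yes_run_hits: "yes (run h) \<subseteq> insert (run_start h) (hits (Run (run_start h)) h)"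
  by (induction h rule: run.induct) (auto simp: yes_Cons)

text \<open>A path from \<open>v\<close> through \<open>c\<close> to \<open>b\<close> that witnesses
  the urgency of \<open>t\<close>; \<open>RY\<close> stands for the edges revealed in the current
  run and \<open>R\<close> for all revealed edges.\<close>

definition run_path :: "edge_set \<Rightarrow> edge_set \<Rightarrow> nat set \<Rightarrow> nat \<Rightarrow> nat \<Rightarrow> nat \<Rightarrow> bool" where
  "run_path RY R t v c b \<longleftrightarrow> v \<in> t \<and> b \<in> t \<and> v \<noteq> b \<and> {v, c} \<in> RY \<and> {c, b} \<in> R"

lemma run_path_mono: "run_path RY R t v c b \<Longrightarrow> RY \<subseteq> RY' \<Longrightarrow> R \<subseteq> R' \<Longrightarrow> run_path RY' R' t v c b"
  by (auto simp: run_path_def)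

section \<open>Triangles of a regular graph and the order of testing\<close>

locale exploration =
  fixes n d :: nat and G :: edge_set and kd kc kr kw :: nat
  assumes regular: "regular_graph n d G"
begin

definition "T = K3_hypergraph G"

lemma triangle:
  assumes "t \<in> T"
  shows "card t = 3" "finite t" "sides t \<subseteq> G" "t \<subseteq> {..<n}"
proof -
  from assms obtain u v w where t: "t = {u, v, w}" "u \<noteq> v" "u \<noteq> w" "v \<noteq> w"
      "{u, v} \<in> G" "{u, w} \<in> G" "{v, w} \<in> G"
    by (auto simp: T_def K3_hypergraph_def)
  show "card t = 3" "finite t" using t by auto
  show "sides t \<subseteq> G" using t sides_triple[of u v w] by auto
  have "{u, v} \<subseteq> {..<n}" "{u, w} \<subseteq> {..<n}"
    using t regular by (auto simp: regular_graph_def all_subsets_def)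
  then show "t \<subseteq> {..<n}" using t by auto
qed

lemma triangle_pair:
  assumes "t \<in> T" "x \<in> t" "y \<in> t" "x \<noteq> y"
  obtains w where "t = {x, y, w}" "w \<noteq> x" "w \<noteq> y"
proof -
  have "card (t - {x, y}) = 1" using assms triangle(1,2)[OF assms(1)] by (simp add: card_Diff_subset)
  then obtain w where "t - {x, y} = {w}" by (auto simp: card_1_singleton_iff)
  then have "t = {x, y, w}" "w \<noteq> x" "w \<noteq> y" using assms by auto
  then show ?thesis by (rule that)
qed

lemma triangle_determined:
  assumes "t \<in> T" "x \<in> t" "y \<in> t" "w \<in> t" "x \<noteq> y" "w \<noteq> x" "w \<noteq> y"
  shows "t = {x, y, w}"
  using triangle_pair[OF assms(1-3,5)] assms(4,6,7) by (metis insertE singletonD)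

lemma finite_G: "finite G"
proof (rule finite_subset)
  show "G \<subseteq> Pow {..<n}" using regular by (auto simp: regular_graph_def all_subsets_def)
qed simp

lemma finite_T: "finite T"
  by (rule finite_subset[of _ "Pow {..<n}"]) (use triangle(4) in blast, simp)

lemma card_incident_le: "card {e \<in> G. x \<in> e} \<le> d"
proof (cases "x < n")
  case False
  then have "{e \<in> G. x \<in> e} = {}" using regular by (auto simp: regular_graph_def all_subsets_def)
  then show ?thesis by (simp only: card.empty)
qed (use regular in \<open>simp add: regular_graph_def\<close>)

text \<open>A triangle through \<open>x\<close> and \<open>y\<close> is determined by its edge from
  \<open>x\<close> to the third vertex.\<close>

lemma card_triangles_pair_le:
  assumes "x \<noteq> y"
  shows "card {t \<in> T. x \<in> t \<and> y \<in> t} \<le> d"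
proof -
  have "{t \<in> T. x \<in> t \<and> y \<in> t} \<subseteq> insert y ` {e \<in> G. x \<in> e}"
  proof
    fix t assume "t \<in> {t \<in> T. x \<in> t \<and> y \<in> t}"
    then have t: "t \<in> T" "x \<in> t" "y \<in> t" by auto
    then obtain w where w: "t = {x, y, w}" "w \<noteq> x" "w \<noteq> y" using triangle_pair[OF t assms] by blast
    then have "{x, w} \<in> G" using triangle(3)[OF t(1)] by (auto simp: pair_in_sides)
    then show "t \<in> insert y ` {e \<in> G. x \<in> e}" using w by (intro image_eqI[of _ _ "{x, w}"]) auto
  qed
  then have "card {t \<in> T. x \<in> t \<and> y \<in> t} \<le> card {e \<in> G. x \<in> e}"
    using finite_G by (intro surj_card_le) auto
  then show ?thesis using card_incident_le[of x] by simp
qed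

lemma card_triangles_at_le: "card {t \<in> T. x \<in> t} \<le> d * d"
proof -
  let ?N = "{e \<in> G. x \<in> e}"
  have "{t \<in> T. x \<in> t} \<subseteq> (\<Union>e\<in>?N. (\<lambda>f. e \<union> f) ` ?N)"
  proof
    fix t assume "t \<in> {t \<in> T. x \<in> t}"
    then have t: "t \<in> T" "x \<in> t" by auto
    have "card (t - {x}) = 2" using triangle(1,2)[OF t(1)] t(2) by simp
    then have "t - {x} \<noteq> {}" by (metis card.empty zero_neq_numeral)
    then obtain y where y: "y \<in> t" "x \<noteq> y" by auto
    then obtain w where w: "t = {x, y, w}" "w \<noteq> x" "w \<noteq> y" using triangle_pair[OF t y] by blast
    then have "{x, w} \<in> G" "{x, y} \<in> G" using y triangle(3)[OF t(1)] by (auto simp: pair_in_sides)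
    then show "t \<in> (\<Union>e\<in>?N. (\<lambda>f. e \<union> f) ` ?N)"
      using w by (intro UN_I[of "{x, w}"] image_eqI[of _ _ "{x, y}"]) auto
  qed
  then have "card {t \<in> T. x \<in> t} \<le> card (\<Union>e\<in>?N. (\<lambda>f. e \<union> f) ` ?N)"
    using finite_G by (intro card_mono) auto
  also have "\<dots> \<le> d * d"
    using finite_G card_incident_le[of x]
    by (intro card_UN_le_mult order_trans[OF card_image_le]) auto
  finally show ?thesis .
qed

definition allowed :: "nat set history \<Rightarrow> nat set \<Rightarrow> bool" where
  "allowed h t \<longleftrightarrow> t \<in> T - tested h \<and>
     (urgent (graph_of h) t \<or> (\<forall>s\<in>T - tested h. \<not> urgent (graph_of h) s))"

text \<open>Only the precedence of urgent triangles is prescribed, so that the counts below hold for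
  every admissible order; \<open>next_test\<close> picks one.\<close>

fun valid :: "nat set history \<Rightarrow> bool" where
  "valid [] \<longleftrightarrow> True"
| "valid ((t, b) # h) \<longleftrightarrow> valid h \<and> allowed h t"

definition next_test :: "nat set history \<Rightarrow> nat set" where
  "next_test h = (SOME t. allowed h t)"

lemma valid_tested: "valid h \<Longrightarrow> tested h \<subseteq> T \<and> distinct (map fst h)"
  by (induction h rule: valid.induct) (auto simp: allowed_def tested_def)

lemma yes_triangle: "valid h \<Longrightarrow> k \<in> yes h \<Longrightarrow> k \<in> T"
  using valid_tested[of h] tested_eq[of h] by auto

lemma allowed_next_test:
  assumes "valid h" "tested h \<noteq> T"
  shows "allowed h (next_test h)"
proof -
  obtain s where s: "s \<in> T - tested h" using valid_tested[OF assms(1)] assms(2) by auto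
  have "\<exists>t. allowed h t"
  proof (cases "\<exists>t\<in>T - tested h. urgent (graph_of h) t")
    case True
    then show ?thesis unfolding allowed_def by blast
  next
    case False
    then have "allowed h s" using s unfolding allowed_def by blast
    then show ?thesis ..
  qed
  then show ?thesis unfolding next_test_def by (rule someI_ex)
qed

definition families :: "family set" where
  "families = Deg ` {..<n} \<union> (\<lambda>(x, y). Cod x y) ` ({..<n} \<times> {..<n}) \<union> Run ` T
     \<union> (\<lambda>(k, x, y). Win k x y) ` (T \<times> {..<n} \<times> {..<n})"

lemma finite_families: "finite families"
  using finite_T by (auto simp: families_def)

text \<open>While no family reaches its threshold, the degrees in the yes graph are at most \<open>2 * kd\<close>, its
  codegrees at most \<open>2 * kc\<close>, and a run has at most \<open>kr\<close> yes triangles, hence at most \<open>3 * kr\<close>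
  vertices. This is where the budgets come from, which bound the number of marked tests.\<close>

fun threshold :: "family \<Rightarrow> nat" where
  "threshold (Deg x) = kd"
| "threshold (Cod x y) = kc"
| "threshold (Run k) = kr"
| "threshold (Win k x y) = kw"

fun budget :: "family \<Rightarrow> nat" where
  "budget (Deg x) = d * d"
| "budget (Cod x y) = 2 * (2 * kd * d) + d"
| "budget (Run k) = (3 * kr) * ((3 * kr) * (2 * kd * d))"
| "budget (Win k x y) = 2 * ((3 * kr) * d + (3 * kr) * (2 * kc * d) + (3 * kr) * (2 * kd * (2 * kd))) + d"

definition good :: "nat set history \<Rightarrow> bool" where
  "good h \<longleftrightarrow> (\<forall>i\<in>families. card (hits i h) < threshold i)"

lemma goodD:
  assumes "good h"
  shows "x < n \<Longrightarrow> card (hits (Deg x) h) < kd" "x < n \<Longrightarrow> y < n \<Longrightarrow> card (hits (Cod x y) h) < kc"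
    "k \<in> T \<Longrightarrow> card (hits (Run k) h) < kr"
    "k \<in> T \<Longrightarrow> x < n \<Longrightarrow> y < n \<Longrightarrow> card (hits (Win k x y) h) < kw"
proof -
  have *: "card (hits i h) < threshold i" if "i \<in> families" for i
    using assms that by (simp add: good_def)
  show "x < n \<Longrightarrow> card (hits (Deg x) h) < kd" "x < n \<Longrightarrow> y < n \<Longrightarrow> card (hits (Cod x y) h) < kc"
    "k \<in> T \<Longrightarrow> card (hits (Run k) h) < kr"
    "k \<in> T \<Longrightarrow> x < n \<Longrightarrow> y < n \<Longrightarrow> card (hits (Win k x y) h) < kw"
    using *[of "Deg x"] *[of "Cod x y"] *[of "Run k"] *[of "Win k x y"]
    by (auto simp: families_def image_iff)
qed

section \<open>Degrees and codegrees of the yes graph\<close>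

lemma graph_of_edge:
  assumes "valid h" "{x, y} \<in> graph_of h"
  shows "x < n" "y < n" "x \<noteq> y"
proof -
  obtain k where k: "k \<in> yes h" "{x, y} \<in> sides k" using assms(2) by (auto simp: revealed_def)
  then show "x < n" "y < n" "x \<noteq> y"
    using triangle(4)[OF yes_triangle[OF assms(1) k(1)]] by (auto simp: pair_in_sides)
qed

lemma finite_nbrs: "valid h \<Longrightarrow> finite (nbrs (graph_of h) x)"
  by (rule finite_subset[of _ "{..<n}"]) (auto simp: nbrs_def dest: graph_of_edge)

lemma card_nbrs_le:
  assumes "valid h" "good h"
  shows "card (nbrs (graph_of h) x) \<le> 2 * kd"
proof (cases "x < n")
  case True
  have "nbrs (graph_of h) x \<subseteq> (\<Union>k\<in>hits (Deg x) h. k - {x})"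
    by (auto simp: nbrs_def revealed_def hits_Deg pair_in_sides)
  then have "card (nbrs (graph_of h) x) \<le> card (\<Union>k\<in>hits (Deg x) h. k - {x})"
    using triangle(2) yes_triangle[OF assms(1)] by (intro card_mono) (auto simp: hits_Deg)
  also have "\<dots> \<le> kd * 2"
  proof (rule card_UN_le_mult)
    show "card (hits (Deg x) h) \<le> kd" using goodD(1)[OF assms(2) True] by simp
    show "card (k - {x}) \<le> 2" if "k \<in> hits (Deg x) h" for k
      using that triangle(1,2)[of k] yes_triangle[OF assms(1), of k] by (auto simp: hits_Deg)
  qed simp
  finally show ?thesis by simp
next
  case False
  then have "nbrs (graph_of h) x = {}" using graph_of_edge(1)[OF assms(1)] by (auto simp: nbrs_def)
  then show ?thesis by simp
qed

text \<open>New common neighbours lie in \<open>t - {x, y}\<close>, and if there is one, then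
  \<open>t\<close> contains \<open>x\<close> or \<open>y\<close>.\<close>

lemma card_common_nbrs_new:
  assumes "t \<in> T" "\<And>e. e \<in> R \<Longrightarrow> card e = 2"
  shows "card (common_nbrs (R \<union> sides t) x y - common_nbrs R x y) \<le> 2"
proof (cases "common_nbrs (R \<union> sides t) x y - common_nbrs R x y = {}")
  case False
  then obtain c where c: "c \<in> common_nbrs (R \<union> sides t) x y" "c \<notin> common_nbrs R x y" by auto
  have sub: "common_nbrs (R \<union> sides t) x y - common_nbrs R x y \<subseteq> t - {x, y}"
    using common_nbrs_new(1)[OF assms(2)] by blast
  have "x \<in> t \<or> y \<in> t" using common_nbrs_new(2)[OF assms(2) c] by blast
  then have "card (t - {x, y}) \<le> 2"
  proof
    assume "x \<in> t"
    then have "card (t - {x}) = 2" using triangle[OF assms(1)] by simp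
    then show ?thesis using triangle(2)[OF assms(1)] card_mono[of "t - {x}" "t - {x, y}"] by auto
  next
    assume "y \<in> t"
    then have "card (t - {y}) = 2" using triangle[OF assms(1)] by simp
    then show ?thesis using triangle(2)[OF assms(1)] card_mono[of "t - {y}" "t - {x, y}"] by auto
  qed
  then show ?thesis using card_mono[OF _ sub] triangle(2)[OF assms(1)] by fastforce
qed (simp only: card.empty)

lemma card_common_nbrs_step:
  assumes "x \<noteq> y" "t \<in> T" "\<And>e. e \<in> R \<Longrightarrow> card e = 2"
  shows "card (common_nbrs (R \<union> sides t) x y)
    \<le> card (common_nbrs R x y) + (if extends_nbrs R x y t then 2 else 0)"
proof (cases "extends_nbrs R x y t")
  case True
  have "common_nbrs (R \<union> sides t) x y
      = common_nbrs R x y \<union> (common_nbrs (R \<union> sides t) x y - common_nbrs R x y)"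
    using common_nbrs_mono[of R "R \<union> sides t" x y] by auto
  then have "card (common_nbrs (R \<union> sides t) x y)
      \<le> card (common_nbrs R x y) + card (common_nbrs (R \<union> sides t) x y - common_nbrs R x y)"
    by (metis card_Un_le)
  then show ?thesis using True card_common_nbrs_new[OF assms(2,3)] by (simp add: order_trans)
qed (use assms(1) in \<open>simp add: extends_nbrs_def\<close>)

lemma card_hits_step:
  assumes "valid ((t, b) # h)"
  shows "card (hits i ((t, b) # h)) = card (hits i h) + (if b \<and> mark i h t then 1 else 0)"
    and "card (marked i ((t, b) # h)) = card (marked i h) + (if mark i h t then 1 else 0)"
proof -
  have "t \<notin> tested h" using assms by (simp add: allowed_def)
  then have "t \<notin> hits i h" "t \<notin> marked i h"
    using hits_subset[of i h] marked_subset[of i h] tested_eq[of h] by auto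
  then show "card (hits i ((t, b) # h)) = card (hits i h) + (if b \<and> mark i h t then 1 else 0)"
    "card (marked i ((t, b) # h)) = card (marked i h) + (if mark i h t then 1 else 0)"
    by auto
qed

lemma card_common_nbrs_hits:
  "valid h \<Longrightarrow> x \<noteq> y \<Longrightarrow> card (common_nbrs (graph_of h) x y) \<le> 2 * card (hits (Cod x y) h)"
proof (induction h rule: valid.induct)
  case 1
  then show ?case by (simp add: common_nbrs_def)
next
  case (2 t b h)
  have "t \<in> T" using 2 by (simp add: allowed_def)
  with 2(3) have step: "card (common_nbrs (graph_of h \<union> sides t) x y)
      \<le> card (common_nbrs (graph_of h) x y) + (if extends_nbrs (graph_of h) x y t then 2 else 0)"
    using card_graph_of by (rule card_common_nbrs_step)
  then show ?case
    using 2 by (auto simp: card_hits_step graph_of_Cons simp del: hits.simps split: if_splits)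
qed

lemma card_common_nbrs_le:
  assumes "valid h" "good h" "x \<noteq> y"
  shows "card (common_nbrs (graph_of h) x y) \<le> 2 * kc"
proof (cases "x < n \<and> y < n")
  case True
  then show ?thesis
    using card_common_nbrs_hits[OF assms(1,3)] goodD(2)[OF assms(2), of x y] by auto
next
  case False
  then have "common_nbrs (graph_of h) x y = {}"
    using graph_of_edge[OF assms(1)] by (auto simp: common_nbrs_def)
  then show ?thesis by simp
qed

lemma finite_common_nbrs: "valid h \<Longrightarrow> finite (common_nbrs (graph_of h) x y)"
  by (rule finite_subset[OF _ finite_nbrs[of h x]]) (auto simp: nbrs_def common_nbrs_def)

text \<open>Within a run, the common neighbours of the ends of an untested triangle side are created in
  that run, since no untested triangle was urgent when it started.\<close>

lemma card_common_nbrs_untested: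
  assumes "valid h" "t \<in> T - tested h" "x \<in> t" "y \<in> t" "x \<noteq> y" "{x, y} \<notin> graph_of h"
  shows "card (common_nbrs (graph_of h) x y) \<le> 2 * (1 + card (hits (Win (run_start h) x y) h))"
  using assms
proof (induction h rule: valid.induct)
  case 1
  then show ?case by (simp add: common_nbrs_def)
next
  case (2 s b h)
  have s: "s \<in> T" using 2 by (simp add: allowed_def)
  have t: "t \<in> T - tested h" and e: "{x, y} \<notin> graph_of h"
    using 2 by (auto simp: graph_of_Cons split: if_splits)
  have step: "card (common_nbrs (graph_of h \<union> sides s) x y)
      \<le> card (common_nbrs (graph_of h) x y) + (if extends_nbrs (graph_of h) x y s then 2 else 0)"
    using \<open>x \<noteq> y\<close> s card_graph_of by (rule card_common_nbrs_step)
  show ?case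
  proof (cases "urgent (graph_of h) s")
    case True
    then show ?thesis
      using 2 t e step card_hits_step(1)[OF 2(2), of "Win (run_start h) x y"]
      by (auto simp: graph_of_Cons simp del: hits.simps split: if_splits)
  next
    \<comment> \<open>The test of \<open>s\<close> opens a run, so no untested triangle was urgent
      before it: \<open>x\<close> and \<open>y\<close> had no common neighbour, and \<open>s\<close>
      adds at most two. Not being urgent, \<open>s\<close> is not marked, which accounts for the 1
      in the bound.\<close>
    case False
    then have "\<not> urgent (graph_of h) t" using 2 t by (auto simp: allowed_def)
    then have "common_nbrs (graph_of h) x y = {}" using 2 by (auto simp: urgent_def)
    then show ?thesis using step by (auto simp: graph_of_Cons simp del: hits.simps split: if_splits)
  qed
qed

text \<open>Just before the current run, no two vertices of an untested triangle had a common
  neighbour. So a path of two revealed edges between two of its vertices uses an edge revealed in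
  the run.\<close>

lemma untested_path:
  assumes "valid h" "t \<in> T - tested h" "v \<in> t" "b \<in> t" "v \<noteq> b"
    "{v, c} \<in> graph_of h" "{c, b} \<in> graph_of h"
  shows "{v, c} \<in> run_edges h \<or> {c, b} \<in> run_edges h"
  using assms
proof (induction h rule: valid.induct)
  case 1
  then show ?case by simp
next
  case (2 s bo h)
  have t: "t \<in> T - tested h" using 2 by auto
  show ?case
  proof (cases "urgent (graph_of h) s")
    case True
    then show ?thesis using 2 t by (auto simp: graph_of_Cons split: if_splits)
  next
    case False
    then have "\<not> urgent (graph_of h) t" using 2 t by (auto simp: allowed_def)
    then have "\<not> ({v, c} \<in> graph_of h \<and> {c, b} \<in> graph_of h)"
      using 2 by (auto simp: urgent_def common_nbrs_def)
    then show ?thesis using 2 False by (auto simp: graph_of_Cons split: if_splits)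
  qed
qed

text \<open>Reversing the path if necessary, its first edge is the one revealed in the run.\<close>

lemma urgent_path:
  assumes "valid h" "t \<in> T - tested h" "urgent (graph_of h) t"
  shows "\<exists>v c b. run_path (run_edges h) (graph_of h) t v c b"
proof -
  obtain v b c where *: "v \<in> t" "b \<in> t" "v \<noteq> b" "{v, c} \<in> graph_of h" "{c, b} \<in> graph_of h"
    using assms(3) by (auto simp: urgent_def common_nbrs_def)
  then have "run_path (run_edges h) (graph_of h) t v c b \<or> run_path (run_edges h) (graph_of h) t b c v"
    using untested_path[OF assms(1,2) *] by (auto simp: run_path_def insert_commute)
  then show ?thesis by blast
qed

end

section \<open>Counting the tests that a family can mark\<close>

context exploration
begin

text \<open>Both edge sets only grow within a run, so the path found when \<open>s\<close> was
  tested persists. This allows all urgent tests of the run to be counted against the current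
  graph.\<close>

lemma run_rest_path:
  "valid h \<Longrightarrow> s \<in> run_rest h \<Longrightarrow> \<exists>v c b. run_path (run_edges h) (graph_of h) s v c b"
proof (induction h rule: valid.induct)
  case 1
  then show ?case by simp
next
  case (2 t b h)
  show ?case
  proof (cases "urgent (graph_of h) t")
    case True
    then have sub: "run_edges h \<subseteq> run_edges ((t, b) # h)" "graph_of h \<subseteq> graph_of ((t, b) # h)"
      by (auto simp: graph_of_Cons)
    have "\<exists>v c b. run_path (run_edges h) (graph_of h) s v c b"
      using 2 True urgent_path[of h t] by (auto simp: allowed_def)
    then show ?thesis using run_path_mono[OF _ sub] by blast
  next
    case False
    then show ?thesis using 2 by simp
  qed
qed

lemma marked_Run_start: "valid h \<Longrightarrow> marked (Run (run_start h)) h \<subseteq> run_rest h"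
proof (induction h rule: valid.induct)
  case (2 t b h)
  show ?case
  proof (cases "urgent (graph_of h) t")
    case False
    have "t \<notin> tested h" using 2 by (simp add: allowed_def)
    then show ?thesis using False marked_Run_untested[of t h] by auto
  qed (use 2 in auto)
qed simp

text \<open>Describes an urgent test of \<open>s\<close> that can make \<open>w\<close> a common
  neighbour of \<open>x\<close> and \<open>y\<close>, where \<open>{x, w}\<close> is a side of
  \<open>s\<close>. The last clause excludes the path from \<open>x\<close> through \<open>y\<close>
  to \<open>w\<close>: if \<open>{x, y}\<close> belonged to the run, this path would serve every
  triangle through \<open>x\<close> and a neighbour of \<open>y\<close>, and these are too many for
  the budget of \<open>Win\<close>.\<close>

definition run_window :: "edge_set \<Rightarrow> edge_set \<Rightarrow> nat \<Rightarrow> nat \<Rightarrow> nat set \<Rightarrow> bool" where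
  "run_window RY R x y s \<longleftrightarrow> x \<in> s \<and> (\<exists>w\<in>s - {x}. {w, y} \<in> R \<and>
     (\<exists>v c b. run_path RY R s v c b \<and> (v = x \<longrightarrow> c \<noteq> y)))"

lemma run_window_mono:
  "run_window RY R x y s \<Longrightarrow> RY \<subseteq> RY' \<Longrightarrow> R \<subseteq> R' \<Longrightarrow> run_window RY' R' x y s"
  unfolding run_window_def using run_path_mono by blast

text \<open>A new common neighbour comes from a triangle containing both \<open>x\<close> and
  \<open>y\<close>, or joins an old edge at one of them to a side at the other. As
  \<open>{x, y}\<close> is not revealed, the path cannot use it, which gives the last clause of
  \<open>run_window\<close>.\<close>

lemma extends_nbrs_window:
  assumes "valid h" "{x, y} \<notin> graph_of h" "extends_nbrs (graph_of h) x y s"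
    and path: "run_path (run_edges h) (graph_of h) s v c b"
  shows "x \<in> s \<and> y \<in> s \<or> run_window (run_edges h) (graph_of h) x y s
    \<or> run_window (run_edges h) (graph_of h) y x s"
proof -
  obtain a where a: "a \<in> common_nbrs (graph_of h \<union> sides s) x y" "a \<notin> common_nbrs (graph_of h) x y"
    using assms(3) common_nbrs_mono[of "graph_of h" "graph_of h \<union> sides s" x y]
    by (auto simp: extends_nbrs_def)
  have "a \<in> s - {x, y}" by (rule common_nbrs_new(1)[OF card_graph_of a])
  moreover have "x \<in> s \<and> y \<in> s \<or> x \<in> s \<and> {a, y} \<in> graph_of h \<or> y \<in> s \<and> {a, x} \<in> graph_of h"
    by (rule common_nbrs_new(2)[OF card_graph_of a])
  moreover have "v = x \<longrightarrow> c \<noteq> y" "v = y \<longrightarrow> c \<noteq> x"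
    using path assms(2) run_edges_subset[of h] by (auto simp: run_path_def insert_commute)
  ultimately show ?thesis using path unfolding run_window_def by blast
qed

lemma marked_Win_start:
  assumes "valid h" "s \<in> marked (Win (run_start h) x y) h"
  shows "x \<in> s \<and> y \<in> s \<or> run_window (run_edges h) (graph_of h) x y s
    \<or> run_window (run_edges h) (graph_of h) y x s"
  using assms
proof (induction h rule: valid.induct)
  case 1
  then show ?case by simp
next
  case (2 t b h)
  show ?case
  proof (cases "urgent (graph_of h) t")
    case True
    then have sub: "run_edges h \<subseteq> run_edges ((t, b) # h)" "graph_of h \<subseteq> graph_of ((t, b) # h)"
      by (auto simp: graph_of_Cons)
    have "x \<in> s \<and> y \<in> s \<or> run_window (run_edges h) (graph_of h) x y s
        \<or> run_window (run_edges h) (graph_of h) y x s"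
    proof (cases "s \<in> marked (Win (run_start h) x y) h")
      case True
      then show ?thesis using 2 by simp
    next
      case False
      then have "s = t" "{x, y} \<notin> graph_of h" "extends_nbrs (graph_of h) x y t"
        using 2(3) \<open>urgent (graph_of h) t\<close> by (auto split: if_splits)
      moreover obtain v c b where "run_path (run_edges h) (graph_of h) t v c b"
        using 2(2) True urgent_path[of h t] by (auto simp: allowed_def)
      ultimately show ?thesis using 2(2) extends_nbrs_window[of h x y t] by auto
    qed
    then show ?thesis using run_window_mono[OF _ sub] by blast
  next
    case False
    have "t \<notin> tested h" using 2 by (simp add: allowed_def)
    then show ?thesis
      using False 2(3) marked_Run_untested[of t h] marked_Win_subset[of t x y h] by auto
  qed
qed

lemma marked_Cod:
  "s \<in> marked (Cod x y) h \<Longrightarrow> x \<in> s \<and> y \<in> s \<or> x \<in> s \<and> (\<exists>w\<in>s - {x}. w \<in> nbrs (graph_of h) y)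
     \<or> y \<in> s \<and> (\<exists>w\<in>s - {y}. w \<in> nbrs (graph_of h) x)"
proof (induction h)
  case Nil
  then show ?case by simp
next
  case (Cons tb h)
  obtain t b where tb: "tb = (t, b)" by (cases tb)
  have mono: "nbrs (graph_of h) z \<subseteq> nbrs (graph_of (tb # h)) z" for z
    by (auto simp: tb nbrs_def graph_of_Cons)
  have "x \<in> s \<and> y \<in> s \<or> x \<in> s \<and> (\<exists>w\<in>s - {x}. w \<in> nbrs (graph_of h) y)
     \<or> y \<in> s \<and> (\<exists>w\<in>s - {y}. w \<in> nbrs (graph_of h) x)"
  proof (cases "s \<in> marked (Cod x y) h")
    case False
    then have s: "s = t" "extends_nbrs (graph_of h) x y s"
      using Cons.prems by (auto simp: tb split: if_splits)
    obtain a where a: "a \<in> common_nbrs (graph_of h \<union> sides s) x y" "a \<notin> common_nbrs (graph_of h) x y"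
      using s(2) common_nbrs_mono[of "graph_of h" "graph_of h \<union> sides s" x y]
      by (auto simp: extends_nbrs_def)
    have "a \<in> s - {x, y}" by (rule common_nbrs_new(1)[OF card_graph_of a])
    moreover have "x \<in> s \<and> y \<in> s \<or> x \<in> s \<and> {a, y} \<in> graph_of h \<or> y \<in> s \<and> {a, x} \<in> graph_of h"
      by (rule common_nbrs_new(2)[OF card_graph_of a])
    ultimately show ?thesis unfolding nbrs_def by (auto simp: insert_commute)
  qed (use Cons.IH in blast)
  then show ?case using mono by blast
qed

lemma card_triangles_pair_UN_le:
  assumes "finite W" "card W \<le> k" "x \<notin> W"
  shows "card {t \<in> T. x \<in> t \<and> (\<exists>w\<in>W. w \<in> t)} \<le> k * d"
proof -
  have "{t \<in> T. x \<in> t \<and> (\<exists>w\<in>W. w \<in> t)} = (\<Union>w\<in>W. {t \<in> T. x \<in> t \<and> w \<in> t})" by auto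
  then show ?thesis
  proof (simp only:, intro card_UN_le_mult assms card_triangles_pair_le)
    show "x \<noteq> w" if "w \<in> W" for w using that assms(3) by blast
  qed
qed

text \<open>The triangle that opens the run is not counted by \<open>Run\<close>; the strict
  inequality in \<open>good\<close> makes room for it.\<close>

lemma card_run_yes:
  assumes "valid h" "good h" "h \<noteq> []"
  shows "card (yes (run h)) \<le> kr"
proof -
  have "run_start h \<in> T" using run_start_tested[OF assms(3)] valid_tested[OF assms(1)] by auto
  then have "card (hits (Run (run_start h)) h) < kr" by (rule goodD(3)[OF assms(2)])
  moreover have "card (yes (run h)) \<le> card (insert (run_start h) (hits (Run (run_start h)) h))"
    by (intro card_mono yes_run_hits) simp
  ultimately show ?thesis by (simp add: card_insert_if split: if_splits)
qed

lemma card_run_vertices: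
  assumes "valid h" "good h"
  shows "finite (\<Union>(yes (run h)))" "card (\<Union>(yes (run h))) \<le> 3 * kr"
proof -
  have tri: "k \<in> T" if "k \<in> yes (run h)" for k
    using that yes_run_subset yes_triangle[OF assms(1)] by auto
  then show "finite (\<Union>(yes (run h)))" using triangle(2) by auto
  have "card (\<Union>k\<in>yes (run h). k) \<le> kr * 3"
  proof (rule card_UN_le_mult)
    show "card (yes (run h)) \<le> kr"
      using card_run_yes[OF assms] by (cases "h = []") auto
  qed (use tri triangle in auto)
  then show "card (\<Union>(yes (run h))) \<le> 3 * kr" by simp
qed

lemma run_path_vertices:
  assumes "run_path (run_edges h) R s v c b"
  shows "v \<in> \<Union>(yes (run h))" "c \<in> \<Union>(yes (run h))"
  using assms by (auto simp: run_path_def revealed_def pair_in_sides)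

text \<open>The vertices \<open>v\<close> and \<open>c\<close> lie in yes triangles of the run,
  which gives the two factors \<open>3 * kr\<close>. Then \<open>b\<close> is a neighbour of
  \<open>c\<close>, and at most \<open>d\<close> triangles contain both \<open>v\<close> and
  \<open>b\<close>.\<close>

lemma card_run_path_le:
  assumes "valid h" "good h"
  shows "card {s \<in> T. \<exists>v c b. run_path (run_edges h) (graph_of h) s v c b}
    \<le> (3 * kr) * ((3 * kr) * (2 * kd * d))"
proof -
  let ?P = "\<Union>(yes (run h))" and ?N = "nbrs (graph_of h)"
  note P = card_run_vertices[OF assms]
  let ?A = "\<Union>v\<in>?P. \<Union>c\<in>?P. {t \<in> T. v \<in> t \<and> (\<exists>b\<in>?N c - {v}. b \<in> t)}"
  have "{s \<in> T. \<exists>v c b. run_path (run_edges h) (graph_of h) s v c b} \<subseteq> ?A"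
  proof
    fix s assume "s \<in> {s \<in> T. \<exists>v c b. run_path (run_edges h) (graph_of h) s v c b}"
    then obtain v c b where *: "s \<in> T" "run_path (run_edges h) (graph_of h) s v c b" by auto
    then have "v \<in> s" "b \<in> s" "b \<in> ?N c - {v}" by (auto simp: run_path_def nbrs_def)
    then show "s \<in> ?A" using run_path_vertices[OF *(2)] *(1) by blast
  qed
  then have "card {s \<in> T. \<exists>v c b. run_path (run_edges h) (graph_of h) s v c b} \<le> card ?A"
    by (intro card_mono finite_subset[OF _ finite_T]) auto
  also have "\<dots> \<le> (3 * kr) * ((3 * kr) * (2 * kd * d))"
  proof (intro card_UN_le_mult P card_triangles_pair_UN_le)
    fix v c
    show "card (?N c - {v}) \<le> 2 * kd"
      using card_nbrs_le[OF assms, of c] card_Diff1_le[of "?N c" v] by (rule order_trans[rotated])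
  qed (use finite_nbrs[OF assms(1)] in auto)
  finally show ?thesis .
qed

text \<open>One summand for each position of the path. If \<open>v\<close> is not \<open>x\<close>,
  the triangle contains \<open>x\<close> and another vertex of the run. If \<open>v = x\<close> and
  \<open>b = w\<close>, then \<open>w\<close> is a common neighbour of \<open>c\<close> and
  \<open>y\<close>, of which there are few because \<open>c\<close> differs from \<open>y\<close>.
  Otherwise the triangle is \<open>{x, b, w}\<close> with \<open>b\<close> adjacent to
  \<open>c\<close> and \<open>w\<close> adjacent to \<open>y\<close>.\<close>

lemma card_run_window_le:
  assumes "valid h" "good h"
  shows "card {s \<in> T. run_window (run_edges h) (graph_of h) x y s}
    \<le> (3 * kr) * d + (3 * kr) * (2 * kc * d) + (3 * kr) * (2 * kd * (2 * kd))"
proof -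
  let ?P = "\<Union>(yes (run h))" and ?N = "nbrs (graph_of h)" and ?C = "common_nbrs (graph_of h)"
  note P = card_run_vertices[OF assms]
  let ?A = "{t \<in> T. x \<in> t \<and> (\<exists>v\<in>?P - {x}. v \<in> t)}"
  let ?B = "\<Union>c\<in>?P - {y}. {t \<in> T. x \<in> t \<and> (\<exists>w\<in>?C c y - {x}. w \<in> t)}"
  let ?D = "\<Union>c\<in>?P. (\<lambda>(b, w). {x, b, w}) ` (?N c \<times> ?N y)"
  have "{s \<in> T. run_window (run_edges h) (graph_of h) x y s} \<subseteq> ?A \<union> ?B \<union> ?D"
  proof
    fix s assume "s \<in> {s \<in> T. run_window (run_edges h) (graph_of h) x y s}"
    then obtain w v c b where s: "s \<in> T" "x \<in> s" "w \<in> s" "w \<noteq> x" "{w, y} \<in> graph_of h"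
        "run_path (run_edges h) (graph_of h) s v c b" "v = x \<longrightarrow> c \<noteq> y"
      by (auto simp: run_window_def)
    note vc = run_path_vertices[OF s(6)]
    have b: "v \<in> s" "b \<in> s" "v \<noteq> b" "{c, b} \<in> graph_of h" using s(6) by (auto simp: run_path_def)
    consider "v \<noteq> x" | "v = x" "b = w" | "v = x" "b \<noteq> w" by blast
    then show "s \<in> ?A \<union> ?B \<union> ?D"
    proof cases
      case 1
      then show ?thesis using s vc b by blast
    next
      case 2
      then have "w \<in> ?C c y" "c \<in> ?P - {y}" using s b vc by (auto simp: common_nbrs_def)
      then show ?thesis using s by blast
    next
      case 3
      then have "s = {x, b, w}" using s b by (intro triangle_determined) auto
      moreover have "b \<in> ?N c" "w \<in> ?N y" using s b by (auto simp: nbrs_def insert_commute)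
      ultimately show ?thesis using vc by blast
    qed
  qed
  moreover have "finite (?A \<union> ?B)" by (rule finite_subset[OF _ finite_T]) auto
  moreover have "finite ?D"
    using P(1) finite_nbrs[OF assms(1)] by (intro finite_UN_I finite_imageI finite_cartesian_product)
  ultimately have "card {s \<in> T. run_window (run_edges h) (graph_of h) x y s} \<le> card (?A \<union> ?B \<union> ?D)"
    using finite_UnI by (intro card_mono) blast+
  also have "\<dots> \<le> card ?A + card ?B + card ?D"
    using card_Un_le[of "?A \<union> ?B" ?D] card_Un_le[of ?A ?B] by linarith
  also have "\<dots> \<le> (3 * kr) * d + (3 * kr) * (2 * kc * d) + (3 * kr) * (2 * kd * (2 * kd))"
  proof (intro add_mono)
    show "card ?A \<le> (3 * kr) * d"
      using P by (intro card_triangles_pair_UN_le order_trans[OF card_Diff1_le]) auto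
    show "card ?B \<le> (3 * kr) * (2 * kc * d)"
    proof (intro card_UN_le_mult card_triangles_pair_UN_le order_trans[OF card_Diff1_le])
      show "card (?C c y) \<le> 2 * kc" if "c \<in> ?P - {y}" for c
        using that by (intro card_common_nbrs_le assms) auto
    qed (use P finite_common_nbrs[OF assms(1)] in auto)
    show "card ?D \<le> (3 * kr) * (2 * kd * (2 * kd))"
    proof (intro card_UN_le_mult P order_trans[OF card_image_le])
      show "card (?N c \<times> ?N y) \<le> 2 * kd * (2 * kd)" for c
        unfolding card_cartesian_product by (intro mult_le_mono card_nbrs_le assms)
    qed (use finite_nbrs[OF assms(1)] in auto)
  qed
  finally show ?thesis .
qed

lemma card_marked_le_budget:
  assumes "valid h" "good h" "allowed h t" "mark i h t"
  shows "card (marked i ((t, b) # h)) \<le> budget i"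
proof -
  \<comment> \<open>The marked set is the same for both answers, and a no changes neither the graph
    nor the hits. So the test of \<open>t\<close> can be included in the count while the history
    stays good.\<close>
  let ?h = "(t, False) # h"
  have v: "valid ?h" using assms by simp
  have mT: "marked i ?h \<subseteq> T"
    using marked_subset[of i ?h] valid_tested[OF v] by (meson subset_trans)
  have eq: "marked i ((t, b) # h) = marked i ?h" by simp
  have hits_eq: "hits j ?h = hits j h" for j by simp
  have g: "good ?h" using assms(2) unfolding good_def hits_eq .
  have "card (marked i ?h) \<le> budget i"
  proof (cases i)
    case (Deg x)
    have "x \<in> s" if "s \<in> marked (Deg x) h'" for s h'
      using that by (induction "Deg x" h' rule: marked.induct) (auto split: if_splits)
    then have "marked i ?h \<subseteq> {t \<in> T. x \<in> t}" using mT Deg by blast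
    then have "card (marked i ?h) \<le> card {t \<in> T. x \<in> t}" using finite_T by (intro card_mono) auto
    then show ?thesis using card_triangles_at_le[of x] unfolding Deg by simp
  next
    case (Cod x y)
    have xy: "x \<noteq> y" using assms(4) Cod by (simp add: extends_nbrs_def)
    let ?N = "nbrs (graph_of ?h)"
    let ?A = "\<lambda>x y. {t \<in> T. x \<in> t \<and> (\<exists>w\<in>?N y - {x}. w \<in> t)}"
    have cA: "card (?A x y) \<le> 2 * kd * d" for x y
      using finite_nbrs[OF v] card_nbrs_le[OF v g]
      by (intro card_triangles_pair_UN_le order_trans[OF card_Diff1_le]) auto
    have "marked i ?h \<subseteq> ?A x y \<union> ?A y x \<union> {t \<in> T. x \<in> t \<and> y \<in> t}"
    proof
      fix s assume s: "s \<in> marked i ?h"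
      then have "s \<in> T" using mT by blast
      with marked_Cod[of s x y ?h] s Cod
      show "s \<in> ?A x y \<union> ?A y x \<union> {t \<in> T. x \<in> t \<and> y \<in> t}" by blast
    qed
    then have "card (marked i ?h) \<le> card (?A x y \<union> ?A y x \<union> {t \<in> T. x \<in> t \<and> y \<in> t})"
      using finite_T by (intro card_mono) auto
    also have "\<dots> \<le> card (?A x y) + card (?A y x) + card {t \<in> T. x \<in> t \<and> y \<in> t}"
      using card_Un_le[of "?A x y \<union> ?A y x" "{t \<in> T. x \<in> t \<and> y \<in> t}"] card_Un_le[of "?A x y" "?A y x"]
      by linarith
    finally show ?thesis
      using cA[of x y] cA[of y x] card_triangles_pair_le[OF xy] unfolding Cod by simp
  next
    case (Run k)
    then have k: "k = run_start ?h" using assms(4) by simp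
    have "marked i ?h \<subseteq> {s \<in> T. \<exists>v c b. run_path (run_edges ?h) (graph_of ?h) s v c b}"
    proof
      fix s assume s: "s \<in> marked i ?h"
      then have "s \<in> run_rest ?h" using marked_Run_start[OF v] unfolding Run k by (rule subsetD[rotated])
      then show "s \<in> {s \<in> T. \<exists>v c b. run_path (run_edges ?h) (graph_of ?h) s v c b}"
        using run_rest_path[OF v, of s] subsetD[OF mT s] by (intro CollectI conjI)
    qed
    then have "card (marked i ?h) \<le> card {s \<in> T. \<exists>v c b. run_path (run_edges ?h) (graph_of ?h) s v c b}"
      using finite_T by (intro card_mono) auto
    then show ?thesis using card_run_path_le[OF v g] unfolding Run budget.simps by (rule order_trans)
  next
    case (Win k x y)
    then have k: "k = run_start ?h" using assms(4) by simp
    have xy: "x \<noteq> y" using assms(4) Win by (simp add: extends_nbrs_def)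
    let ?W = "\<lambda>x y. {s \<in> T. run_window (run_edges ?h) (graph_of ?h) x y s}"
    have "marked i ?h \<subseteq> ?W x y \<union> ?W y x \<union> {t \<in> T. x \<in> t \<and> y \<in> t}"
    proof
      fix s assume s: "s \<in> marked i ?h"
      then have "x \<in> s \<and> y \<in> s \<or> run_window (run_edges ?h) (graph_of ?h) x y s
          \<or> run_window (run_edges ?h) (graph_of ?h) y x s"
        unfolding Win k by (rule marked_Win_start[OF v])
      then show "s \<in> ?W x y \<union> ?W y x \<union> {t \<in> T. x \<in> t \<and> y \<in> t}"
        using subsetD[OF mT s] by blast
    qed
    then have "card (marked i ?h) \<le> card (?W x y \<union> ?W y x \<union> {t \<in> T. x \<in> t \<and> y \<in> t})"
      using finite_T by (intro card_mono) auto
    also have "\<dots> \<le> card (?W x y) + card (?W y x) + card {t \<in> T. x \<in> t \<and> y \<in> t}"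
      using card_Un_le[of "?W x y \<union> ?W y x" "{t \<in> T. x \<in> t \<and> y \<in> t}"] card_Un_le[of "?W x y" "?W y x"]
      by linarith
    also have "\<dots> \<le> budget i"
      unfolding Win budget.simps mult_2[of "_ + _"]
      by (intro add_mono[of _ _ _ d] add_mono card_run_window_le[OF v g] card_triangles_pair_le[OF xy])
    finally show ?thesis .
  qed
  then show ?thesis unfolding eq .
qed

end

section \<open>Conditional probability of a positive test\<close>

context exploration
begin

lemma card_common_nbrs_window:
  assumes "valid h" "good h" "t \<in> T - tested h" "x \<in> t" "y \<in> t" "x \<noteq> y" "{x, y} \<notin> graph_of h"
  shows "card (common_nbrs (graph_of h) x y) \<le> 2 * kw"
proof (cases "h = []")
  case True
  then show ?thesis by (simp add: common_nbrs_def)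
next
  case False
  have "run_start h \<in> T" using run_start_tested[OF False] valid_tested[OF assms(1)] by auto
  moreover have "x < n" "y < n" using assms triangle(4)[of t] by auto
  ultimately have "card (hits (Win (run_start h) x y) h) < kw" by (rule goodD(4)[OF assms(2)])
  then have "2 * (1 + card (hits (Win (run_start h) x y) h)) \<le> 2 * kw" by simp
  with card_common_nbrs_untested[OF assms(1,3-7)] show ?thesis by (rule order_trans)
qed

text \<open>Such a triangle is \<open>{x, y, c}\<close> with \<open>c\<close> outside the untested
  \<open>t\<close>, so that \<open>{x, c}\<close> and \<open>{y, c}\<close> contribute a factor
  \<open>p\<close> each unless revealed. If both are revealed, \<open>c\<close> is one of at most
  \<open>2 * kw\<close> common neighbours and the coin gives \<open>m\<close>; if exactly one is,
  \<open>c\<close> is one of at most \<open>2 * (2 * kd)\<close> neighbours; all others number at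
  most \<open>d\<close>.\<close>

lemma sum_absent_at_side:
  fixes \<theta> :: "nat set \<Rightarrow> real"
  assumes h: "valid h" "good h" and t: "t \<in> T - tested h"
    and xy: "x \<in> t" "y \<in> t" "x \<noteq> y" "{x, y} \<notin> graph_of h"
    and p: "0 \<le> p" "p \<le> 1" and \<theta>: "\<And>s. 0 \<le> \<theta> s \<and> \<theta> s \<le> m" and m: "m \<le> 1"
  shows "(\<Sum>s\<in>{s \<in> no h. {x, y} \<in> sides s}. \<theta> s * p ^ card (sides s - (graph_of h \<union> sides t)))
    \<le> m * real (2 * kw) + p * real (2 * (2 * kd)) + p\<^sup>2 * real d"
proof -
  let ?R = "graph_of h"
  let ?S = "{s \<in> no h. {x, y} \<in> sides s}"
  let ?S1 = "(\<lambda>c. {x, y, c}) ` common_nbrs ?R x y"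
  let ?S2 = "(\<lambda>c. {x, y, c}) ` (nbrs ?R x \<union> nbrs ?R y)"
  let ?f = "\<lambda>s. \<theta> s * p ^ card (sides s - (?R \<union> sides t))"
  have m0: "0 \<le> m" using \<theta> order_trans by blast
  have S: "?S \<subseteq> {s \<in> T. x \<in> s \<and> y \<in> s}"
    using valid_tested[OF h(1)] tested_eq[of h] by (auto simp: pair_in_sides)
  have point: "?f s \<le> (if s \<in> ?S1 then m else 0) + (if s \<in> ?S2 then p else 0) + p\<^sup>2" if s: "s \<in> ?S" for s
  proof -
    have sT: "s \<in> T" "x \<in> s" "y \<in> s" using s S by auto
    then obtain c where c: "s = {x, y, c}" "c \<noteq> x" "c \<noteq> y" using triangle_pair xy(3) by metis
    have "c \<notin> t"
    proof
      assume "c \<in> t"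
      then have "t = s" using t xy c triangle_determined[of t x y c] by auto
      then show False using s t tested_eq[of h] by auto
    qed
    then have ct: "{x, c} \<notin> sides t" "{y, c} \<notin> sides t" by (auto simp: pair_in_sides)
    have sc: "{x, c} \<in> sides s" "{y, c} \<in> sides s" using c by (auto simp: pair_in_sides)
    have fin: "finite (sides s - (?R \<union> sides t))"
      using triangle(3)[OF sT(1)] finite_G by (meson finite_Diff finite_subset)
    have pow: "p ^ card (sides s - (?R \<union> sides t)) \<le> p ^ k" if "k \<le> card (sides s - (?R \<union> sides t))" for k
      using that p by (rule power_decreasing)
    have le: "?f s \<le> p ^ k" if "k \<le> card (sides s - (?R \<union> sides t))" for k
      using \<theta>[of s] m p pow[OF that] mult_mono[of "\<theta> s" 1 "p ^ card (sides s - (?R \<union> sides t))" "p ^ k"]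
      by auto
    consider "c \<in> common_nbrs ?R x y" | "c \<in> nbrs ?R x \<union> nbrs ?R y" "{x, c} \<notin> ?R \<or> {y, c} \<notin> ?R"
      | "{x, c} \<notin> ?R" "{y, c} \<notin> ?R"
      by (auto simp: common_nbrs_def nbrs_def insert_commute)
    then show ?thesis
    proof cases
      case 1
      have "?f s \<le> \<theta> s" using \<theta>[of s] p by (simp add: mult_left_le power_le_one)
      moreover have "s \<in> ?S1" using 1 c by blast
      ultimately show ?thesis using \<theta>[of s] p by (auto intro: add_increasing2)
    next
      case 2
      have "sides s - (?R \<union> sides t) \<noteq> {}" using 2 sc ct by blast
      then have "1 \<le> card (sides s - (?R \<union> sides t))" using fin by (simp add: Suc_le_eq card_gt_0_iff)
      from le[OF this] have "?f s \<le> p" by simp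
      moreover have "s \<in> ?S2" using 2 c by blast
      ultimately show ?thesis using m0 p by (auto intro: add_increasing2)
    next
      case 3
      have "{{x, c}, {y, c}} \<subseteq> sides s - (?R \<union> sides t)" using 3 sc ct by blast
      moreover have "card {{x, c}, {y, c}} = 2" using xy(3) c by (auto simp: doubleton_eq_iff)
      ultimately have "2 \<le> card (sides s - (?R \<union> sides t))" using card_mono[OF fin] by metis
      from le[OF this] show ?thesis using m0 p by (auto intro: order_trans)
    qed
  qed
  have ind: "(\<Sum>s\<in>?S. if s \<in> A then b else 0) \<le> b * real k" if "0 \<le> b" "finite A" "card A \<le> k" for A and b :: real and k
  proof -
    have "(\<Sum>s\<in>?S. if s \<in> A then b else 0) = b * real (card (?S \<inter> A))"
      by (simp add: sum.inter_restrict[symmetric])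
    moreover have "card (?S \<inter> A) \<le> k" using that card_mono[of A "?S \<inter> A"] by force
    ultimately show ?thesis using that(1) by (simp add: mult_left_mono)
  qed
  have "(\<Sum>s\<in>?S. ?f s)
      \<le> (\<Sum>s\<in>?S. (if s \<in> ?S1 then m else 0) + (if s \<in> ?S2 then p else 0) + p\<^sup>2)"
    by (intro sum_mono point)
  also have "\<dots> = (\<Sum>s\<in>?S. if s \<in> ?S1 then m else 0) + (\<Sum>s\<in>?S. if s \<in> ?S2 then p else 0)
      + p\<^sup>2 * real (card ?S)"
    by (simp add: sum.distrib)
  also have "\<dots> \<le> m * real (2 * kw) + p * real (2 * (2 * kd)) + p\<^sup>2 * real d"
  proof (intro add_mono ind m0 p)
    show "finite ?S1" "finite ?S2" using finite_common_nbrs[OF h(1)] finite_nbrs[OF h(1)] by auto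
    show "card ?S1 \<le> 2 * kw"
      using card_image_le[OF finite_common_nbrs[OF h(1)]] card_common_nbrs_window[OF h t xy]
      by (rule order_trans)
    have "card ?S2 \<le> card (nbrs ?R x \<union> nbrs ?R y)"
      using finite_nbrs[OF h(1)] by (intro card_image_le) auto
    also have "\<dots> \<le> 2 * (2 * kd)"
      using card_Un_le[of "nbrs ?R x" "nbrs ?R y"] card_nbrs_le[OF h, of x] card_nbrs_le[OF h, of y]
      by linarith
    finally show "card ?S2 \<le> 2 * (2 * kd)" .
    have "card ?S \<le> card {s \<in> T. x \<in> s \<and> y \<in> s}" using S finite_T by (intro card_mono) auto
    then have "card ?S \<le> d" using card_triangles_pair_le[OF xy(3)] by (rule order_trans)
    then show "p\<^sup>2 * real (card ?S) \<le> p\<^sup>2 * real d" by (intro mult_left_mono) auto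
  qed
  finally show ?thesis .
qed

lemma card_sides_le: "t \<in> T \<Longrightarrow> card (sides t) \<le> 3"
proof -
  assume "t \<in> T"
  then obtain u v w where t: "t = {u, v, w}" by (auto simp: T_def K3_hypergraph_def)
  have "card (sides t) \<le> card {{u, v}, {u, w}, {v, w}}"
    unfolding t by (intro card_mono sides_triple) simp
  also have "\<dots> \<le> 3" by (simp add: card_insert_if)
  finally show ?thesis .
qed

text \<open>Every no triangle that depends on the unrevealed sides of \<open>t\<close> contains one
  of them, and there are at most three, hence the factor 3 in the smallness condition. The exponent
  \<open>card B\<close> may be raised to 3 since \<open>p\<close> is at most 1.\<close>

lemma up_mass_test_lower:
  fixes \<theta> :: "nat set \<Rightarrow> real"
  assumes h: "valid h" "good h" and t: "t \<in> T - tested h"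
    and p: "0 \<le> p" "p \<le> 1" and \<theta>: "\<And>s. 0 \<le> \<theta> s \<and> \<theta> s \<le> m" and m: "m \<le> 1"
    and small: "3 * (m * real (2 * kw) + p * real (2 * (2 * kd)) + p\<^sup>2 * real d) \<le> 1 / 2"
  shows "p ^ 3 / 2 * up_mass G p (graph_of h) (thin_weight sides \<theta> (no h))
    \<le> up_mass G p (graph_of h \<union> sides t) (thin_weight sides \<theta> (no h))"
proof -
  let ?R = "graph_of h"
  define B where "B = sides t - ?R"
  define q where "q = m * real (2 * kw) + p * real (2 * (2 * kd)) + p\<^sup>2 * real d"
  let ?f = "\<lambda>s. \<theta> s * p ^ card (sides s - (?R \<union> sides t))"
  let ?N1 = "{s \<in> no h. sides s \<inter> B \<noteq> {}}"
  have RB: "?R \<union> B = ?R \<union> sides t" by (auto simp: B_def)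
  have tG: "sides t \<subseteq> G" using t triangle(3) by blast
  have finB: "finite B" and cardB: "card B \<le> 3"
    using card_sides_le[of t] t card_mono[of "sides t" B] finite_subset[OF tG finite_G]
    by (auto simp: B_def)
  have th1: "0 \<le> \<theta> s \<and> \<theta> s \<le> 1" for s using \<theta>[of s] m by auto
  have f0: "0 \<le> ?f s" for s using th1[of s] p by simp
  have "(\<Sum>s\<in>?N1. ?f s) \<le> (\<Sum>s\<in>?N1. \<Sum>e\<in>B. if e \<in> sides s then ?f s else 0)"
  proof (intro sum_mono)
    fix s assume "s \<in> ?N1"
    then obtain e where e: "e \<in> B" "e \<in> sides s" by blast
    have "(if e \<in> sides s then ?f s else 0) \<le> (\<Sum>e\<in>B. if e \<in> sides s then ?f s else 0)"
      using e finB f0 by (intro member_le_sum) auto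
    then show "?f s \<le> (\<Sum>e\<in>B. if e \<in> sides s then ?f s else 0)" using e by simp
  qed
  also have "\<dots> = (\<Sum>e\<in>B. \<Sum>s\<in>?N1. if e \<in> sides s then ?f s else 0)"
    by (rule sum.swap)
  also have "\<dots> \<le> (\<Sum>e\<in>B. q)"
  proof (intro sum_mono)
    fix e assume e: "e \<in> B"
    then obtain x y where xy: "e = {x, y}" "x \<in> t" "y \<in> t" "x \<noteq> y" "{x, y} \<notin> ?R"
      by (auto simp: B_def elim: sides_pairE)
    have "(\<Sum>s\<in>?N1. if e \<in> sides s then ?f s else 0) = (\<Sum>s\<in>{s \<in> ?N1. e \<in> sides s}. ?f s)"
      by (rule sum.mono_neutral_cong_right) auto
    also have "{s \<in> ?N1. e \<in> sides s} = {s \<in> no h. {x, y} \<in> sides s}" using e xy by auto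
    finally show "(\<Sum>s\<in>?N1. if e \<in> sides s then ?f s else 0) \<le> q"
      unfolding q_def using sum_absent_at_side[OF h t xy(2-5) p \<theta> m] by simp
  qed
  also have "\<dots> \<le> 3 * q"
  proof -
    have "0 \<le> m" using \<theta>[of "{}"] by linarith
    then have "0 \<le> q" unfolding q_def using p by (intro add_nonneg_nonneg mult_nonneg_nonneg) auto
    then show ?thesis using cardB by (simp add: mult_right_mono)
  qed
  also have "\<dots> \<le> 1 / 2" using small by (simp add: q_def)
  finally have "(\<Sum>s\<in>?N1. ?f s) \<le> 1 / 2" .
  then have "p ^ card B / 2 * up_mass G p ?R (thin_weight sides \<theta> (no h))
      \<le> up_mass G p (?R \<union> B) (thin_weight sides \<theta> (no h))"
    using finite_G p th1 tG valid_tested[OF h(1)] tested_eq[of h] triangle(3)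
    by (intro up_mass_thin_lower) (auto simp: B_def RB[unfolded B_def], blast)
  moreover have "p ^ 3 / 2 * up_mass G p ?R (thin_weight sides \<theta> (no h))
      \<le> p ^ card B / 2 * up_mass G p ?R (thin_weight sides \<theta> (no h))"
    using p cardB thin_weight_bounds(1)[of "no h" \<theta> sides] th1
    by (intro mult_right_mono divide_right_mono power_decreasing up_mass_nonneg) auto
  ultimately show ?thesis unfolding RB by linarith
qed

text \<open>The exponential supermartingale. The term of a family bounds, as in Markov's inequality,
  the conditional probability that its hits reach the threshold; each marked test that the budget
  still allows contributes the moment factor \<open>1 + \<pi> * (z i - 1)\<close>. The sum over the
  families is a union bound.\<close>

definition potential :: "(family \<Rightarrow> real) \<Rightarrow> real \<Rightarrow> nat set history \<Rightarrow> real" where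
  "potential z \<pi> h = (\<Sum>i\<in>families. z i ^ card (hits i h) / z i ^ threshold i
     * (1 + \<pi> * (z i - 1)) ^ (budget i - card (marked i h)))"

lemma potential_term_nonneg:
  fixes z :: real
  assumes "1 \<le> z" "0 \<le> \<pi>"
  shows "0 \<le> z ^ a / z ^ b * (1 + \<pi> * (z - 1)) ^ c"
  using assms by (intro mult_nonneg_nonneg divide_nonneg_nonneg zero_le_power) auto

text \<open>A family at its threshold would contribute at least 1 on its own.\<close>

lemma good_of_potential:
  assumes "\<And>i. 1 \<le> z i" "0 \<le> \<pi>" "potential z \<pi> h < 1"
  shows "good h"
  unfolding good_def
proof (rule ballI, rule ccontr)
  fix i assume i: "i \<in> families" "\<not> card (hits i h) < threshold i"
  let ?u = "\<lambda>i. z i ^ card (hits i h) / z i ^ threshold i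
     * (1 + \<pi> * (z i - 1)) ^ (budget i - card (marked i h))"
  have zi: "1 \<le> z i" by (rule assms(1))
  have "1 * 1 \<le> ?u i"
  proof (rule mult_mono)
    have "z i ^ threshold i \<le> z i ^ card (hits i h)" using i(2) zi by (intro power_increasing) auto
    then show "1 \<le> z i ^ card (hits i h) / z i ^ threshold i" using zi by (simp add: le_divide_eq)
    show "1 \<le> (1 + \<pi> * (z i - 1)) ^ (budget i - card (marked i h))"
      using zi assms(2) by (intro one_le_power) simp
  qed (use zi in auto)
  also have "?u i \<le> potential z \<pi> h"
    unfolding potential_def
    using i(1) finite_families by (intro member_le_sum potential_term_nonneg assms) auto
  finally show False using assms(3) by simp
qed

text \<open>A marked test multiplies \<open>z i ^ card (hits i h)\<close> by
  \<open>1 + \<pi> * (z i - 1)\<close> on average and uses up one unit of the budget, so the two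
  effects cancel. An unmarked test leaves the term as it is.\<close>

lemma potential_step:
  assumes z: "\<And>i. 1 \<le> z i" and \<pi>: "0 \<le> \<pi>" and h: "valid h" "good h" "allowed h t"
  shows "\<pi> * potential z \<pi> ((t, True) # h) + (1 - \<pi>) * potential z \<pi> ((t, False) # h)
    \<le> potential z \<pi> h"
  unfolding potential_def sum_distrib_left sum.distrib[symmetric]
proof (rule sum_mono)
  fix i assume "i \<in> families"
  have v: "valid ((t, b) # h)" for b using h by simp
  let ?g = "1 + \<pi> * (z i - 1)"
  have z0: "0 < z i" using z[of i] by linarith
  show "\<pi> * (z i ^ card (hits i ((t, True) # h)) / z i ^ threshold i
        * ?g ^ (budget i - card (marked i ((t, True) # h))))
      + (1 - \<pi>) * (z i ^ card (hits i ((t, False) # h)) / z i ^ threshold i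
        * ?g ^ (budget i - card (marked i ((t, False) # h))))
      \<le> z i ^ card (hits i h) / z i ^ threshold i * ?g ^ (budget i - card (marked i h))"
  proof (cases "mark i h t")
    case False
    have "\<pi> * X + (1 - \<pi>) * X = X" for X by (simp add: algebra_simps)
    with False show ?thesis
      unfolding card_hits_step[OF v] by (simp only: simp_thms if_False add_0_right order_refl)
  next
    case True
    define k where "k = budget i - (card (marked i h) + 1)"
    \<comment> \<open>The test still fits into the budget, so the truncated subtraction really drops
      by one.\<close>
    have "card (marked i h) + 1 \<le> budget i"
      using card_marked_le_budget[OF h True, of True] card_hits_step(2)[OF v, of i True] True by simp
    then have k: "budget i - card (marked i h) = Suc k" by (simp add: k_def)
    have "\<pi> * (z i ^ (card (hits i h) + 1) / z i ^ threshold i * ?g ^ k)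
        + (1 - \<pi>) * (z i ^ card (hits i h) / z i ^ threshold i * ?g ^ k)
        = z i ^ card (hits i h) / z i ^ threshold i * ?g ^ Suc k"
      by (simp add: algebra_simps add_divide_distrib diff_divide_distrib)
    then show ?thesis
      unfolding card_hits_step[OF v] k using True by (simp add: k_def)
  qed
qed

text \<open>The exploration starts from the empty history, whose posterior and history law are the
  two Bernoulli weights. A good history leaves each untested triangle present with conditional
  probability at least \<open>p ^ 3 / 2\<close>, so \<open>\<pi> \<le> m * (p ^ 3 / 2)\<close> keeps
  every coin bias at most \<open>m\<close>.\<close>

lemma triangle_coupling:
  assumes p: "0 \<le> p" "p \<le> 1" and m: "0 \<le> m" "m \<le> 1" and \<pi>: "0 \<le> \<pi>" "\<pi> \<le> 1" "\<pi> \<le> m * (p ^ 3 / 2)"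
    and z: "\<And>i. 1 \<le> z i"
    and small: "3 * (m * real (2 * kw) + p * real (2 * (2 * kd)) + p\<^sup>2 * real d) \<le> 1 / 2"
  shows "\<exists>c. mass_coupling G T (bernoulli_weight G p) (bernoulli_weight T \<pi>) c \<and>
    defect G T sides c \<le> potential z \<pi> []"
proof -
  have good: "good h" if "potential z \<pi> h < 1" for h
    using z \<pi>(1) that by (rule good_of_potential)
  have "\<exists>c. mass_coupling G T (posterior G p sides 1 (\<lambda>_. 0) []) (hist_mass T \<pi> []) c \<and>
    defect G T sides c \<le> sum (posterior G p sides 1 (\<lambda>_. 0) []) (Pow G) * potential z \<pi> []"
  proof (rule exploration_coupling[where V = valid and ntest = next_test and m = m])
    fix h b assume "valid h" "tested h \<noteq> T"
    then show "next_test h \<in> T - tested h \<and> valid ((next_test h, b) # h)"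
      using allowed_next_test[of h] by (auto simp: allowed_def)
  next
    fix h assume "valid h"
    show "0 \<le> potential z \<pi> h"
      unfolding potential_def using z \<pi> by (intro sum_nonneg potential_term_nonneg) auto
  next
    fix h assume "valid h" "tested h \<noteq> T" "potential z \<pi> h < 1"
    then show "\<pi> * potential z \<pi> ((next_test h, True) # h)
        + (1 - \<pi>) * potential z \<pi> ((next_test h, False) # h) \<le> potential z \<pi> h"
      by (intro potential_step z \<pi> good allowed_next_test)
  next
    fix h and \<theta> :: "nat set \<Rightarrow> real"
    assume h: "valid h" "tested h \<noteq> T" "potential z \<pi> h < 1" and \<theta>: "\<And>s. 0 \<le> \<theta> s \<and> \<theta> s \<le> m"
    let ?M = "up_mass G p (graph_of h) (thin_weight sides \<theta> (no h))"
    have t: "next_test h \<in> T - tested h" using allowed_next_test[OF h(1,2)] by (simp add: allowed_def)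
    have th1: "0 \<le> \<theta> s \<and> \<theta> s \<le> 1" for s using \<theta>[of s] m by auto
    have "\<pi> * ?M \<le> m * (p ^ 3 / 2) * ?M"
      using \<pi>(3) p thin_weight_bounds(1)[of "no h" \<theta> sides] th1
      by (intro mult_right_mono up_mass_nonneg) auto
    also have "\<dots> \<le> m * up_mass G p (graph_of h \<union> sides (next_test h)) (thin_weight sides \<theta> (no h))"
      unfolding mult.assoc
      by (intro mult_left_mono up_mass_test_lower[OF h(1) good[OF h(3)] t p \<theta> m(2) small] m(1))
    finally show "\<pi> * ?M
        \<le> m * up_mass G p (graph_of h \<union> sides (next_test h)) (thin_weight sides \<theta> (no h))" .
  qed (use finite_T finite_G p \<pi> m valid_tested in auto)
  moreover have "posterior G p sides 1 (\<lambda>_. 0) [] = bernoulli_weight G p"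
    by (rule ext) (simp add: posterior_def thin_weight_def)
  moreover have "hist_mass T \<pi> [] = bernoulli_weight T \<pi>"
    by (rule ext) (simp add: hist_mass_def)
  ultimately show ?thesis using bernoulli_weight_total[OF finite_G, of p] by simp
qed

section \<open>Initial value of the supermartingale\<close>

lemma sum_families:
  fixes f :: "family \<Rightarrow> real"
  shows "sum f families = (\<Sum>x<n. f (Deg x)) + (\<Sum>(x, y)\<in>{..<n} \<times> {..<n}. f (Cod x y))
    + (\<Sum>k\<in>T. f (Run k)) + (\<Sum>(k, x, y)\<in>T \<times> {..<n} \<times> {..<n}. f (Win k x y))"
proof -
  let ?D = "Deg ` {..<n}" and ?C = "(\<lambda>(x, y). Cod x y) ` ({..<n} \<times> {..<n})" and ?R = "Run ` T"
    and ?W = "(\<lambda>(k, x, y). Win k x y) ` (T \<times> {..<n} \<times> {..<n})"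
  have "sum f families = sum f ?D + sum f ?C + sum f ?R + sum f ?W"
    unfolding families_def using finite_T
    by (subst sum.union_disjoint; (subst sum.union_disjoint)?; (subst sum.union_disjoint)?; auto)
  moreover have "inj_on Deg {..<n}" "inj_on (\<lambda>(x, y). Cod x y) ({..<n} \<times> {..<n})" "inj_on Run T"
      "inj_on (\<lambda>(k, x, y). Win k x y) (T \<times> {..<n} \<times> {..<n})"
    by (auto simp: inj_on_def)
  ultimately show ?thesis
    by (simp add: sum.reindex case_prod_unfold comp_def)
qed

lemma card_T_le: "card T \<le> n * (d * d)"
proof -
  have "T \<subseteq> (\<Union>x<n. {t \<in> T. x \<in> t})"
  proof
    fix t assume t: "t \<in> T"
    then obtain x where "x \<in> t" using triangle(1)[OF t] by fastforce
    then show "t \<in> (\<Union>x<n. {t \<in> T. x \<in> t})" using triangle(4)[OF t] t by auto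
  qed
  then have "card T \<le> card (\<Union>x<n. {t \<in> T. x \<in> t})" using finite_T by (intro card_mono) auto
  also have "\<dots> \<le> n * (d * d)" by (intro card_UN_le_mult card_triangles_at_le) auto
  finally show ?thesis .
qed

lemma potential_term_initial:
  fixes z \<pi> :: real
  assumes "1 \<le> z" "0 \<le> \<pi>"
  shows "1 / z ^ k * (1 + \<pi> * (z - 1)) ^ b \<le> exp (\<pi> * z * real b) / z ^ k"
proof -
  have "1 + \<pi> * (z - 1) \<le> exp (\<pi> * z)"
    using exp_ge_add_one_self[of "\<pi> * z"] assms unfolding right_diff_distrib by linarith
  moreover have "0 \<le> 1 + \<pi> * (z - 1)" using assms by simp
  ultimately have "(1 + \<pi> * (z - 1)) ^ b \<le> exp (\<pi> * z) ^ b" by (rule power_mono)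
  also have "\<dots> = exp (\<pi> * z * real b)" by (simp add: exp_of_nat_mult[symmetric] mult.commute)
  finally show ?thesis using assms by (simp add: divide_right_mono)
qed

text \<open>All families of one kind have the same initial term; the powers of \<open>n\<close>
  bound their number, with at most \<open>n ^ 3\<close> triangles.\<close>

lemma potential_initial_le:
  fixes zD zC zR zW \<pi> :: real
  assumes z: "1 \<le> zD" "1 \<le> zC" "1 \<le> zR" "1 \<le> zW" and \<pi>: "0 \<le> \<pi>" and d: "d \<le> n"
    and bound: "exp (\<pi> * zD * real (d * d)) / zD ^ kd \<le> bD"
      "exp (\<pi> * zC * real (2 * (2 * kd * d) + d)) / zC ^ kc \<le> bC"
      "exp (\<pi> * zR * real ((3 * kr) * ((3 * kr) * (2 * kd * d)))) / zR ^ kr \<le> bR"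
      "exp (\<pi> * zW * real (2 * ((3 * kr) * d + (3 * kr) * (2 * kc * d)
         + (3 * kr) * (2 * kd * (2 * kd))) + d)) / zW ^ kw \<le> bW"
  shows "potential (case_family (\<lambda>_. zD) (\<lambda>_ _. zC) (\<lambda>_. zR) (\<lambda>_ _ _. zW)) \<pi> []
    \<le> real n * bD + real n ^ 2 * bC + real n ^ 3 * bR + real n ^ 5 * bW"
proof -
  note le = potential_term_initial[OF z(1) \<pi>, of kd "d * d", THEN order_trans, OF bound(1)]
    potential_term_initial[OF z(2) \<pi>, of kc "2 * (2 * kd * d) + d", THEN order_trans, OF bound(2)]
    potential_term_initial[OF z(3) \<pi>, of kr "(3 * kr) * ((3 * kr) * (2 * kd * d))",
      THEN order_trans, OF bound(3)]
    potential_term_initial[OF z(4) \<pi>, of kw "2 * ((3 * kr) * d + (3 * kr) * (2 * kc * d)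
         + (3 * kr) * (2 * kd * (2 * kd))) + d", THEN order_trans, OF bound(4)]
  have b0: "0 \<le> bR" "0 \<le> bW"
    using bound(3,4) z by (auto intro: order_trans[rotated])
  have T3: "real (card T) \<le> real n ^ 3"
  proof -
    have "card T \<le> n * (n * n)" using card_T_le d by (meson le_trans mult_le_mono order_refl)
    then have "real (card T) \<le> real (n * (n * n))" by (rule of_nat_mono)
    then show ?thesis by (simp add: power3_eq_cube mult.assoc)
  qed
  let ?z = "case_family (\<lambda>_. zD) (\<lambda>_ _. zC) (\<lambda>_. zR) (\<lambda>_ _ _. zW)"
  let ?u = "\<lambda>i. 1 / ?z i ^ threshold i * (1 + \<pi> * (?z i - 1)) ^ budget i"
  have "potential ?z \<pi> [] = sum ?u families"
    by (simp add: potential_def)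
  also have "\<dots> = (\<Sum>x<n. ?u (Deg x)) + (\<Sum>(x, y)\<in>{..<n} \<times> {..<n}. ?u (Cod x y))
    + (\<Sum>k\<in>T. ?u (Run k)) + (\<Sum>(k, x, y)\<in>T \<times> {..<n} \<times> {..<n}. ?u (Win k x y))"
    by (rule sum_families)
  also have "\<dots> \<le> (\<Sum>x<n. bD) + (\<Sum>q\<in>{..<n} \<times> {..<n}. bC) + (\<Sum>k\<in>T. bR)
      + (\<Sum>q\<in>T \<times> {..<n} \<times> {..<n}. bW)"
    using le by (intro add_mono sum_mono) (simp_all add: case_prod_unfold)
  also have "\<dots> = real n * bD + real n ^ 2 * bC + real (card T) * bR + real (card T) * real n ^ 2 * bW"
    by (simp add: card_cartesian_product power2_eq_square)
  also have "\<dots> \<le> real n * bD + real n ^ 2 * bC + real n ^ 3 * bR + real n ^ 3 * real n ^ 2 * bW"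
    using T3 b0 by (intro add_mono mult_right_mono order_refl) auto
  also have "real n ^ 3 * real n ^ 2 = real n ^ 5" by (simp add: power_add[symmetric])
  finally show ?thesis .
qed

end

section \<open>Random subsets as probability mass functions\<close>

lemma pmf_binomial_subset:
  assumes "finite S" "0 \<le> q" "q \<le> 1"
  shows "pmf (binomial_subset S q) F = (if F \<subseteq> S then bernoulli_weight S q F else 0)"
proof -
  let ?P = "Pi_pmf S False (\<lambda>_. bernoulli_pmf q)"
  let ?\<chi> = "\<lambda>x. x \<in> F"
  have supp: "f \<in> set_pmf ?P \<Longrightarrow> x \<notin> S \<Longrightarrow> f x = False" for f x
    using set_Pi_pmf_subset[OF assms(1), of False "\<lambda>_. bernoulli_pmf q"] by auto
  have "pmf (binomial_subset S q) F = measure_pmf.prob ?P ((\<lambda>f. {x \<in> S. f x}) -` {F})"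
    by (simp add: binomial_subset_def pmf_map)
  also have "\<dots> = measure_pmf.prob ?P ((\<lambda>f. {x \<in> S. f x}) -` {F} \<inter> set_pmf ?P)"
    by (simp add: measure_Int_set_pmf)
  also have "(\<lambda>f. {x \<in> S. f x}) -` {F} \<inter> set_pmf ?P = (if F \<subseteq> S then {?\<chi>} else {}) \<inter> set_pmf ?P"
    using supp by (auto simp: fun_eq_iff)
  also have "measure_pmf.prob ?P \<dots> = (if F \<subseteq> S then pmf ?P ?\<chi> else 0)"
    by (simp only: measure_Int_set_pmf) (simp add: measure_pmf_single)
  also have "\<dots> = (if F \<subseteq> S then bernoulli_weight S q F else 0)"
    using assms by (auto simp: pmf_Pi bernoulli_weight_def intro!: prod.cong)
  finally show ?thesis .
qed

lemma binomial_subset_restrict: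
  assumes "finite A" "S \<subseteq> A"
  shows "map_pmf (\<lambda>E. S \<inter> E) (binomial_subset A q) = binomial_subset S q"
  unfolding binomial_subset_def Pi_pmf_subset[OF assms] map_pmf_comp
  using assms(2) by (intro map_pmf_cong) auto

text \<open>Extending the masses by 0 outside \<open>Pow X \<times> Pow T\<close> gives a mass
  function on all pairs. The event records \<open>F \<subseteq> T\<close> too, from which the
  members of \<open>F\<close> will later be known to be triangles.\<close>

lemma pmf_of_mass_coupling:
  fixes c :: "'a set \<Rightarrow> 't set \<Rightarrow> real"
  assumes fin: "finite X" "finite T" and p: "0 \<le> p" "p \<le> 1" and \<pi>: "0 \<le> \<pi>" "\<pi> \<le> 1"
    and c: "mass_coupling X T (bernoulli_weight X p) (bernoulli_weight T \<pi>) c"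
  shows "\<exists>Q. is_coupling Q (binomial_subset X p) (binomial_subset T \<pi>) \<and>
    measure_pmf.prob Q {(E, F). F \<subseteq> T \<and> (\<forall>t\<in>F. \<sigma> t \<subseteq> E)} \<ge> 1 - defect X T \<sigma> c"
proof -
  let ?S = "Pow X \<times> Pow T"
  define f where "f = (\<lambda>(E, F). if E \<subseteq> X \<and> F \<subseteq> T then c E F else 0)"
  have finS: "finite ?S" using fin by simp
  have f0: "0 \<le> f x" for x using c by (auto simp: f_def mass_coupling_def split: prod.splits)
  have row: "(\<Sum>F\<in>Pow T. c E F) = bernoulli_weight X p E" if "E \<subseteq> X" for E
    using c that by (simp add: mass_coupling_def)
  have col: "(\<Sum>E\<in>Pow X. c E F) = bernoulli_weight T \<pi> F" if "F \<subseteq> T" for F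
    using c that bernoulli_weight_total[OF fin(1), of p] by (simp add: mass_coupling_def)
  have total: "(\<Sum>x\<in>?S. f x) = 1"
    unfolding sum.cartesian_product' using bernoulli_weight_total[OF fin(1), of p]
    by (simp add: f_def row)
  have "(\<integral>\<^sup>+ x. ennreal (f x) \<partial>count_space UNIV) = (\<Sum>x\<in>?S. ennreal (f x))"
    using finS f0 by (intro nn_integral_count_space') (auto simp: f_def split: if_splits)
  also have "\<dots> = 1" using total f0 by (simp add: sum_ennreal)
  finally have pmf: "pmf (embed_pmf f) x = f x" for x by (intro pmf_embed_pmf f0)
  define Q where "Q = embed_pmf f"
  have supp: "set_pmf Q \<subseteq> ?S"
  proof
    fix x assume "x \<in> set_pmf Q"
    then have "f x \<noteq> 0" by (simp add: Q_def set_pmf_eq pmf)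
    then show "x \<in> ?S" by (auto simp: f_def split: prod.splits if_splits)
  qed
  have prob: "measure_pmf.prob Q A = (\<Sum>x\<in>?S. if x \<in> A then f x else 0)" for A
  proof -
    have "measure_pmf.prob Q A = measure_pmf.prob Q (A \<inter> ?S \<inter> set_pmf Q)"
      using supp by (metis Int_absorb1 Int_assoc measure_Int_set_pmf)
    also have "\<dots> = (\<Sum>x\<in>A \<inter> ?S. pmf Q x)"
      using finS by (simp only: measure_Int_set_pmf) (intro measure_measure_pmf_finite, blast)
    also have "\<dots> = (\<Sum>x\<in>?S. if x \<in> A then f x else 0)"
      using finS by (simp add: Q_def pmf sum.inter_restrict Int_commute[of A])
    finally show ?thesis .
  qed
  have "map_pmf fst Q = binomial_subset X p"
  proof (rule pmf_eqI)
    fix E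
    have "pmf (map_pmf fst Q) E = (\<Sum>E'\<in>Pow X. if E' = E then (\<Sum>F\<in>Pow T. c E' F) else 0)"
      unfolding pmf_map prob sum.cartesian_product'
      by (intro sum.cong refl) (auto simp: f_def intro!: sum.cong)
    also have "\<dots> = pmf (binomial_subset X p) E"
      using fin p by (simp add: pmf_binomial_subset row)
    finally show "pmf (map_pmf fst Q) E = pmf (binomial_subset X p) E" .
  qed
  moreover have "map_pmf snd Q = binomial_subset T \<pi>"
  proof (rule pmf_eqI)
    fix F
    have "pmf (map_pmf snd Q) F = (\<Sum>E\<in>Pow X. \<Sum>F'\<in>Pow T. if F' = F then c E F' else 0)"
      unfolding pmf_map prob sum.cartesian_product'
      by (intro sum.cong refl) (auto simp: f_def)
    also have "\<dots> = (\<Sum>F'\<in>Pow T. if F' = F then (\<Sum>E\<in>Pow X. c E F') else 0)"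
      by (subst sum.swap) (auto intro!: sum.cong)
    also have "\<dots> = pmf (binomial_subset T \<pi>) F"
      using fin \<pi> by (simp add: pmf_binomial_subset col)
    finally show "pmf (map_pmf snd Q) F = pmf (binomial_subset T \<pi>) F" .
  qed
  moreover have "measure_pmf.prob Q {(E, F). F \<subseteq> T \<and> (\<forall>t\<in>F. \<sigma> t \<subseteq> E)} = 1 - defect X T \<sigma> c"
  proof -
    have "defect X T \<sigma> c = (\<Sum>x\<in>?S. if \<forall>t\<in>snd x. \<sigma> t \<subseteq> fst x then 0 else f x)"
      unfolding defect_def sum.cartesian_product' by (intro sum.cong refl) (auto simp: f_def)
    moreover have "measure_pmf.prob Q {(E, F). F \<subseteq> T \<and> (\<forall>t\<in>F. \<sigma> t \<subseteq> E)}
        = (\<Sum>x\<in>?S. if \<forall>t\<in>snd x. \<sigma> t \<subseteq> fst x then f x else 0)"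
      unfolding prob by (intro sum.cong refl) (auto, blast+)
    moreover have "(\<Sum>x\<in>?S. if \<forall>t\<in>snd x. \<sigma> t \<subseteq> fst x then f x else 0)
        + (\<Sum>x\<in>?S. if \<forall>t\<in>snd x. \<sigma> t \<subseteq> fst x then 0 else f x) = 1"
      unfolding sum.distrib[symmetric] total[symmetric] by (intro sum.cong) auto
    ultimately show ?thesis by linarith
  qed
  ultimately show ?thesis by (auto simp: is_coupling_def)
qed

section \<open>Numerical estimates\<close>

text \<open>Throughout, \<open>s\<close> plays the role of \<open>n powr (1 / 3)\<close> and \<open>L\<close> that of \<open>ln n\<close>.\<close>

lemma dense_test_bounds:
  fixes s L d \<pi> kd :: real
  assumes L: "1 \<le> L" and s: "1 \<le> s" and d: "120 * s\<^sup>2 * L \<le> d"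
    and \<pi>: "0 \<le> \<pi>" "\<pi> \<le> s ^ 3 * L / (1024 * d ^ 3)" and kd: "1 \<le> kd" "kd \<le> s"
  shows "\<pi> * d\<^sup>2 \<le> s / 1024" "\<pi> * (kd * d) * L \<le> 1 / 10000000" "\<pi> * d * s \<le> 1 / 10000000"
proof -
  have pos: "0 < s" "0 < L" "0 < s\<^sup>2 * L" using s L by auto
  have d0: "0 < d" using d pos(3) by (simp add: mult.assoc)
  have pd: "\<pi> * d ^ 3 \<le> s ^ 3 * L / 1024"
    using mult_right_mono[OF \<pi>(2), of "d ^ 3"] d0 by (simp add: field_simps)
  have "\<pi> * d\<^sup>2 * d \<le> s ^ 3 * L / 1024" using pd by (simp add: power2_eq_square power3_eq_cube mult.assoc)
  also have "\<dots> \<le> s / 1024 * (120 * s\<^sup>2 * L)" using pos by (simp add: power2_eq_square power3_eq_cube)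
  also have "\<dots> \<le> s / 1024 * d" using d pos by (intro mult_left_mono) auto
  finally show 1: "\<pi> * d\<^sup>2 \<le> s / 1024" using d0 by simp
  have "14400 * (s ^ 4 * L\<^sup>2) = (120 * s\<^sup>2 * L) * (120 * s\<^sup>2 * L)" by (simp add: power2_eq_square power4_eq_xxxx)
  also have "\<dots> \<le> d * d" by (rule mult_mono[OF d d]) (use d0 s L in simp_all)
  finally have dd: "14400 * (s ^ 4 * L\<^sup>2) \<le> d * d" .
  have "\<pi> * d * s * L * (d * d) = \<pi> * d ^ 3 * (s * L)" by (simp add: power3_eq_cube)
  also have "\<dots> \<le> s ^ 3 * L / 1024 * (s * L)" using pd pos by (intro mult_right_mono) auto
  also have "\<dots> = s ^ 4 * L\<^sup>2 / 1024" by (simp add: power2_eq_square power4_eq_xxxx power3_eq_cube)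
  \<comment> \<open>The product of 14400 and 1024 exceeds 10000000.\<close>
  also have "\<dots> \<le> 1 / 10000000 * (14400 * (s ^ 4 * L\<^sup>2))" by simp
  also have "\<dots> \<le> 1 / 10000000 * (d * d)" using dd by (intro mult_left_mono) auto
  finally have key: "\<pi> * d * s * L \<le> 1 / 10000000"
    using d0 by (metis mult_le_cancel_right_pos mult_pos_pos)
  have "\<pi> * (kd * d) * L \<le> \<pi> * (s * d) * L"
    using kd \<pi> d0 pos by (intro mult_right_mono mult_left_mono) auto
  then show "\<pi> * (kd * d) * L \<le> 1 / 10000000" using key by (simp add: mult_ac)
  have "\<pi> * d * s * 1 \<le> \<pi> * d * s * L" using \<pi> d0 pos L by (intro mult_left_mono) auto
  then show "\<pi> * d * s \<le> 1 / 10000000" using key by linarith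
qed

text \<open>Here \<open>l\<close> is the cube root of \<open>L\<close>, so that \<open>s * l\<close>
  stands for the cube root of \<open>n * ln n\<close>.\<close>

lemma dense_density_bounds:
  fixes s l d p kd :: real
  assumes l: "1 \<le> l" and s: "1 \<le> s" and d: "120 * s\<^sup>2 * l ^ 3 \<le> d"
    and p: "0 \<le> p" "p \<le> s * l / d" and kd: "0 \<le> kd" "kd \<le> s"
  shows "p * kd \<le> 1 / 120" "p\<^sup>2 * d \<le> 1 / 120"
proof -
  have d0: "0 < d" using d l s by (smt (verit) mult_pos_pos zero_less_power)
  have pd: "p * d \<le> s * l" using p(2) d0 by (simp add: field_simps)
  have ll: "l \<le> l\<^sup>2" "l\<^sup>2 \<le> l ^ 3" using l by (auto simp: power2_eq_square power3_eq_cube)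
  then have sl: "s\<^sup>2 * l \<le> d / 120" "s\<^sup>2 * l\<^sup>2 \<le> d / 120"
    using d mult_left_mono[of "l\<^sup>2" "l ^ 3" "s\<^sup>2"] mult_left_mono[of l "l\<^sup>2" "s\<^sup>2"] by auto
  have "p * kd * d = p * d * kd" by simp
  also have "\<dots> \<le> s * l * s" by (rule mult_mono[OF pd kd(2)]) (use kd s l in auto)
  also have "\<dots> \<le> 1 / 120 * d" using sl by (simp add: power2_eq_square mult_ac)
  finally show "p * kd \<le> 1 / 120" using d0 by (metis mult_le_cancel_right_pos)
  have "p\<^sup>2 * d * d = (p * d) * (p * d)" by (simp add: power2_eq_square)
  also have "\<dots> \<le> (s * l) * (s * l)" by (rule mult_mono[OF pd pd]) (use p d0 s l in auto)
  also have "\<dots> \<le> 1 / 120 * d" using sl by (simp add: power2_eq_square mult_ac)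
  finally show "p\<^sup>2 * d \<le> 1 / 120" using d0 by (metis mult_le_cancel_right_pos)
qed

lemma exp_le_3_pow: "exp (real k) \<le> 3 ^ k"
  using power_mono[OF exp_le, of k] by (simp add: exp_of_nat_mult[symmetric])

text \<open>Apply \<open>ln y \<le> y\<close> to \<open>y = N powr (1 / 24)\<close>; the exponents
  add up as 1/4 + 2/24 = 1/3.\<close>

lemma ln_square_le:
  fixes N :: real
  assumes "1 \<le> N"
  shows "N powr (1 / 4) * (ln N)\<^sup>2 \<le> 576 * N powr (1 / 3)"
proof -
  have "ln N = 24 * ln (N powr (1 / 24))" using assms by (simp add: ln_powr)
  also have "ln (N powr (1 / 24)) \<le> N powr (1 / 24)"
    using assms ln_less_self[of "N powr (1 / 24)"] by simp
  finally have "(ln N)\<^sup>2 \<le> (24 * N powr (1 / 24))\<^sup>2" using assms by (intro power_mono) auto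
  also have "\<dots> = 576 * N powr (1 / 12)"
    using assms by (simp add: power_mult_distrib powr_power)
  finally have "N powr (1 / 4) * (ln N)\<^sup>2 \<le> N powr (1 / 4) * (576 * N powr (1 / 12))"
    by (intro mult_left_mono) auto
  also have "\<dots> = 576 * N powr (1 / 3)" using assms by (simp add: powr_add[symmetric])
  finally show ?thesis .
qed

text \<open>The four bounds have to beat about \<open>n\<close>, \<open>n ^ 2\<close>,
  \<open>n ^ 3\<close> and \<open>n ^ 5\<close> families. A threshold of order \<open>s\<close>
  needs only the base \<open>exp 1\<close>, the logarithmic ones need \<open>exp 3\<close> and
  \<open>exp 5\<close>, and the constant threshold 32 needs a power of \<open>N\<close>.\<close>

lemma budget_exponent_bounds:
  fixes N d \<pi> :: real and kd kc kr :: nat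
  defines "s \<equiv> N powr (1 / 3)" and "L \<equiv> ln N"
  assumes N: "3 \<le> N" and d: "120 * s\<^sup>2 * L \<le> d"
    and \<pi>: "0 \<le> \<pi>" "\<pi> \<le> s ^ 3 * L / (1024 * d ^ 3)"
    and kd: "1 \<le> kd" "real kd \<le> s" "s - 1 \<le> real kd"
    and kc: "L \<le> real kc" "real kc \<le> L + 1" and kr: "L \<le> real kr" "real kr \<le> L + 2"
  shows "exp (\<pi> * exp 1 * (d * d)) / exp 1 ^ kd \<le> exp (1 - s / 2)"
    "exp (\<pi> * exp 3 * (2 * (2 * kd * d) + d)) / exp 3 ^ kc \<le> exp 1 / N ^ 3"
    "exp (\<pi> * exp 5 * ((3 * kr) * ((3 * kr) * (2 * kd * d)))) / exp 5 ^ kr \<le> 1 / N ^ 4"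
    "exp (\<pi> * N powr (1 / 4) * (2 * ((3 * kr) * d + (3 * kr) * (2 * kc * d)
       + (3 * kr) * (2 * kd * (2 * kd))) + d)) / (N powr (1 / 4)) ^ 32 \<le> exp 1 / N ^ 8"
proof -
  have "exp 1 \<le> N" using exp_le N by linarith
  then have L: "1 \<le> L" unfolding L_def using N by (subst ln_ge_iff) auto
  have s: "1 \<le> s" unfolding s_def using N by (intro ge_one_powr_ge_zero) auto
  have kd1: "1 \<le> real kd" using kd(1) by simp
  \<comment> \<open>The first bound serves \<open>Deg\<close>, the second \<open>Cod\<close> and
    \<open>Run\<close>, and the third \<open>Win\<close>, where
    \<open>N powr (1 / 4) * L\<^sup>2\<close> is absorbed into \<open>s\<close>.\<close>
  note b = dense_test_bounds[OF L s d \<pi> kd1 kd(2)]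
  have d0: "0 < d" using d L s by (smt (verit) mult_pos_pos zero_less_power)
  have N_pow: "exp (real k * L) = N ^ k" for k unfolding L_def using N by (simp add: exp_of_nat_mult)
  have e: "exp 1 \<le> (3::real)" "exp 3 \<le> (27::real)" "exp 5 \<le> (243::real)"
    using exp_le_3_pow[of 1] exp_le_3_pow[of 3] exp_le_3_pow[of 5] by auto
  have "\<pi> * exp 1 * (d * d) = \<pi> * d\<^sup>2 * exp 1" by (simp add: power2_eq_square)
  also have "\<dots> \<le> s / 1024 * 3" using b(1) e \<pi> s by (intro mult_mono) auto
  finally have "\<pi> * exp 1 * (d * d) - real kd \<le> 1 - s / 2" using kd s by linarith
  then show "exp (\<pi> * exp 1 * (d * d)) / exp 1 ^ kd \<le> exp (1 - s / 2)"
    by (simp add: exp_of_nat_mult[symmetric] exp_diff[symmetric])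
  have pkd: "\<pi> * (kd * d) * 1 \<le> \<pi> * (kd * d) * L"
    using \<pi> d0 L by (intro mult_left_mono) auto
  have kdd: "d \<le> kd * d" using kd1 d0 by simp
  have "\<pi> * exp 3 * (2 * (2 * kd * d) + d) \<le> \<pi> * 27 * (5 * (kd * d))"
    using \<pi> d0 e kdd by (intro mult_mono) auto
  also have "\<dots> \<le> 1" using pkd b(2) by linarith
  finally have "\<pi> * exp 3 * (2 * (2 * kd * d) + d) - kc * 3 \<le> 1 - real 3 * L" using kc by simp
  then have "exp (\<pi> * exp 3 * (2 * (2 * kd * d) + d) - kc * 3) \<le> exp (1 - real 3 * L)" by simp
  then show "exp (\<pi> * exp 3 * (2 * (2 * kd * d) + d)) / exp 3 ^ kc \<le> exp 1 / N ^ 3"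
    unfolding exp_diff N_pow by (simp add: exp_of_nat_mult)
  have krL: "real kr \<le> 3 * L" using kr L by linarith
  have K: "real (3 * kr) * (real (3 * kr) * (2 * kd * d)) \<le> (9 * L) * ((9 * L) * (2 * kd * d))"
    using krL d0 L by (intro mult_mono) auto
  have "\<pi> * exp 5 * (real (3 * kr) * (real (3 * kr) * (2 * kd * d)))
      \<le> \<pi> * 243 * ((9 * L) * ((9 * L) * (2 * kd * d)))"
    by (rule mult_mono[OF mult_left_mono[OF e(3) \<pi>(1)] K]) (use \<pi> d0 in auto)
  \<comment> \<open>The constant is 243 * 9 * 9 * 2. The product is well below \<open>L\<close>, so
    that of the \<open>5 * L\<close> gained from the threshold at least \<open>4 * L\<close>
    remain.\<close>
  also have "\<dots> = 39366 * L * (\<pi> * (kd * d) * L)" by simp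
  also have "\<dots> \<le> 39366 * L * (1 / 10000000)" using b(2) L by (intro mult_left_mono) auto
  finally have "\<pi> * exp 5 * (real (3 * kr) * (real (3 * kr) * (2 * kd * d)))
      \<le> 39366 * L * (1 / 10000000)" .
  then have "\<pi> * exp 5 * (real (3 * kr) * (real (3 * kr) * (2 * kd * d))) - kr * 5 \<le> - (real 4 * L)"
    using kr L by linarith
  then have "exp (\<pi> * exp 5 * (real (3 * kr) * (real (3 * kr) * (2 * kd * d))) - kr * 5)
      \<le> exp (- (real 4 * L))" by simp
  then show "exp (\<pi> * exp 5 * ((3 * kr) * ((3 * kr) * (2 * kd * d)))) / exp 5 ^ kr \<le> 1 / N ^ 4"
    unfolding exp_diff exp_minus N_pow by (simp add: exp_of_nat_mult inverse_eq_divide)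
  have LL: "L \<le> L\<^sup>2" "1 \<le> L\<^sup>2" using L by (auto simp: power2_eq_square mult_ge1_I)
  have kcL: "real kc \<le> 2 * L" using kc L by linarith
  have Ld: "L * d \<le> L\<^sup>2 * d" "d \<le> L\<^sup>2 * d" using LL d0 by auto
  have sd: "s\<^sup>2 \<le> d"
  proof -
    have "s\<^sup>2 * 1 \<le> s\<^sup>2 * (120 * L)" using L by (intro mult_left_mono) auto
    then show ?thesis using d by (simp add: mult_ac)
  qed
  have "real (3 * kr) * d \<le> 9 * (L\<^sup>2 * d)"
  proof -
    have "real (3 * kr) * d \<le> 9 * L * d" using krL d0 by (intro mult_right_mono) auto
    then show ?thesis using Ld by linarith
  qed
  moreover have "real (3 * kr) * (2 * kc * d) \<le> 36 * (L\<^sup>2 * d)"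
  proof -
    have "real (3 * kr) * (2 * kc * d) \<le> (9 * L) * (2 * (2 * L) * d)"
      using krL kcL d0 L by (intro mult_mono) auto
    then show ?thesis by (simp add: power2_eq_square)
  qed
  moreover have "real (3 * kr) * (2 * kd * (2 * kd)) \<le> 36 * (L\<^sup>2 * d)"
  proof -
    have "real kd * real kd \<le> d" using mult_mono[OF kd(2) kd(2)] s sd by (simp add: power2_eq_square)
    then have "real (3 * kr) * (2 * kd * (2 * kd)) \<le> (9 * L) * (4 * d)"
      using krL L by (intro mult_mono) auto
    then show ?thesis using Ld by linarith
  qed
  \<comment> \<open>The constant 163 is 2 * (9 + 36 + 36) + 1.\<close>
  moreover have "2 * (x + y + z) + d \<le> 163 * X"
    if "x \<le> 9 * X" "y \<le> 36 * X" "z \<le> 36 * X" "d \<le> X" for x y z X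
    using that unfolding distrib_left by linarith
  ultimately have B: "2 * (real (3 * kr) * d + real (3 * kr) * (2 * kc * d)
       + real (3 * kr) * (2 * kd * (2 * kd))) + d \<le> 163 * (L\<^sup>2 * d)"
    using Ld(2) by blast
  have w0: "0 < N powr (1 / 4)" using N by simp
  have "\<pi> * N powr (1 / 4) * (2 * (real (3 * kr) * d + real (3 * kr) * (2 * kc * d)
       + real (3 * kr) * (2 * kd * (2 * kd))) + d) \<le> \<pi> * N powr (1 / 4) * (163 * (L\<^sup>2 * d))"
    using B \<pi> w0 by (intro mult_left_mono) auto
  also have "\<dots> = 163 * (\<pi> * d * (N powr (1 / 4) * L\<^sup>2))" by simp
  also have "\<dots> \<le> 163 * (\<pi> * d * (576 * s))"
    using ln_square_le[of N] N \<pi> d0 unfolding s_def L_def by (intro mult_left_mono) auto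
  also have "\<dots> \<le> 1" using b(3) by simp
  finally have "exp (\<pi> * N powr (1 / 4) * (2 * (real (3 * kr) * d + real (3 * kr) * (2 * kc * d)
       + real (3 * kr) * (2 * kd * (2 * kd))) + d)) \<le> exp 1" by simp
  moreover have "(N powr (1 / 4)) ^ 32 = N ^ 8"
    using N by (simp add: powr_power powr_numeral)
  ultimately show "exp (\<pi> * N powr (1 / 4) * (2 * ((3 * kr) * d + (3 * kr) * (2 * kc * d)
       + (3 * kr) * (2 * kd * (2 * kd))) + d)) / (N powr (1 / 4)) ^ 32 \<le> exp 1 / N ^ 8"
    using N by (simp add: divide_right_mono)
qed

definition failure_bound :: "real \<Rightarrow> real" where
  "failure_bound N = N * exp (1 - N powr (1 / 3) / 2) + N ^ 2 * (exp 1 / N ^ 3) + N ^ 3 * (1 / N ^ 4)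
     + N ^ 5 * (exp 1 / N ^ 8)"

lemma failure_bound_tendsto: "(\<lambda>n. failure_bound (real n)) \<longlonglongrightarrow> 0"
proof -
  have "(failure_bound \<longlongrightarrow> 0) at_top"
    unfolding failure_bound_def by real_asymp
  then show ?thesis using filterlim_real_sequentially by (rule filterlim_compose)
qed

section \<open>Choice of the parameters and conclusion\<close>

lemma K3_hypergraph_mem:
  assumes "h \<in> K3_hypergraph G" "sides h \<subseteq> E"
  shows "h \<in> K3_hypergraph E"
proof -
  obtain u v w where h: "h = {u, v, w}" "u \<noteq> v" "u \<noteq> w" "v \<noteq> w"
    using assms(1) by (auto simp: K3_hypergraph_def)
  then have "{u, v} \<in> E" "{u, w} \<in> E" "{v, w} \<in> E"
    using assms(2) by (auto simp: pair_in_sides subset_iff)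
  then show ?thesis using h unfolding K3_hypergraph_def by blast
qed

lemma finite_all_subsets: "finite (all_subsets n r)"
  by (rule finite_subset[of _ "Pow {..<n}"]) (auto simp: all_subsets_def)

lemma regular_graph_coupling:
  fixes n d :: nat and a q :: real
  defines "s \<equiv> real n powr (1 / 3)" and "L \<equiv> ln (real n)"
  assumes reg: "regular_graph n d G" and n: "3 \<le> n" and dn: "d \<le> n"
    and dense: "120 * s\<^sup>2 * L \<le> real d"
    and a: "0 < a" "a < 1 / 2 ^ 10"
    and q: "0 \<le> q" "q \<le> 1" "q \<le> (real n * L) powr (1 / 3) / real d"
  shows "\<exists>Q. is_coupling Q (binomial_subset G q) (binomial_subset (K3_hypergraph G) (a * q ^ 3)) \<and>
    measure_pmf.prob Q {(E, F). \<forall>h\<in>F. h \<in> K3_hypergraph E} \<ge> 1 - failure_bound (real n)"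
proof -
  \<comment> \<open>The expected number of yes triangles at a vertex is at most
    \<open>\<pi> * d\<^sup>2 \<le> s / 1024\<close>, which leaves ample room below a threshold of
    order \<open>s\<close>. The remaining thresholds are logarithmic, except for the constant 32
    within a run.\<close>
  define kd where "kd = nat \<lfloor>s\<rfloor>"
  define kc where "kc = nat \<lceil>L\<rceil>"
  define kr where "kr = nat \<lceil>L\<rceil> + 1"
  define \<pi> where "\<pi> = a * q ^ 3"
  define w where "w = real n powr (1 / 4)"
  define l where "l = L powr (1 / 3)"
  have N: "3 \<le> real n" using n by simp
  then have "exp 1 \<le> real n" using exp_le by linarith
  then have L: "1 \<le> L" unfolding L_def using N by (subst ln_ge_iff) auto
  have s: "1 \<le> s" unfolding s_def using N by (intro ge_one_powr_ge_zero) auto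
  have l: "1 \<le> l" "l ^ 3 = L"
    unfolding l_def using L by (auto intro: ge_one_powr_ge_zero simp: powr_power)
  have w: "1 \<le> w" unfolding w_def using N by (intro ge_one_powr_ge_zero) auto
  have kd: "1 \<le> kd" "real kd \<le> s" "s - 1 \<le> real kd"
    using s unfolding kd_def by linarith+
  have kc: "L \<le> real kc" "real kc \<le> L + 1" and kr: "L \<le> real kr" "real kr \<le> L + 2"
    using L unfolding kc_def kr_def by linarith+
  have d0: "0 < real d" using dense L s by (smt (verit) mult_pos_pos zero_less_power)
  have "(real n * L) powr (1 / 3) = s * l"
    unfolding s_def l_def by (rule powr_mult)
  then have ql: "q \<le> s * l / real d" using q by simp
  have q3: "q ^ 3 \<le> s ^ 3 * L / real d ^ 3"
    using power_mono[OF ql q(1), of 3] by (simp add: power_divide power_mult_distrib l)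
  have "a * q ^ 3 \<le> 1 / 1024 * (s ^ 3 * L / real d ^ 3)"
    by (rule mult_mono[OF _ q3]) (use a q in auto)
  then have \<pi>: "0 \<le> \<pi>" "\<pi> \<le> s ^ 3 * L / (1024 * real d ^ 3)"
    unfolding \<pi>_def using a q by simp_all
  have "a * q ^ 3 \<le> 1 * 1" using a q by (intro mult_mono power_le_one) auto
  then have \<pi>1: "\<pi> \<le> 1" by (simp add: \<pi>_def)
  note b = dense_density_bounds[OF l(1) s dense[folded l(2)] q(1) ql _ kd(2)]
  interpret exploration n d G kd kc kr 32
    by (rule exploration.intro[OF reg])
  \<comment> \<open>With \<open>m = 2 * a\<close> the requirement
    \<open>\<pi> \<le> m * (q ^ 3 / 2)\<close> is an equality. The three summands are at most 1/8,
    1/30 and 1/120, which add up to exactly 1/6: this is how 1/1024, 32 and 120 fit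
    together.\<close>
  have small: "3 * (2 * a * real (2 * 32) + q * real (2 * (2 * kd)) + q\<^sup>2 * real d) \<le> 1 / 2"
    using b a by simp
  let ?z = "case_family (\<lambda>_. exp 1) (\<lambda>_ _. exp 3) (\<lambda>_. exp 5) (\<lambda>_ _ _. w) :: family \<Rightarrow> real"
  have "1 \<le> ?z i" for i using w by (cases i) auto
  then obtain c where c: "mass_coupling G T (bernoulli_weight G q) (bernoulli_weight T \<pi>) c"
      "defect G T sides c \<le> potential ?z \<pi> []"
    using triangle_coupling[OF q(1,2) _ _ \<pi>(1) \<pi>1 _ _ small, of ?z] a by (auto simp: \<pi>_def)
  note e = budget_exponent_bounds[OF N dense[unfolded s_def L_def] \<pi>(1) \<pi>(2)[unfolded s_def L_def] kd(1)
      kd(2,3)[unfolded s_def] kc[unfolded L_def] kr[unfolded L_def]]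
  have "potential ?z \<pi> [] \<le> failure_bound (real n)"
    unfolding failure_bound_def
    by (rule potential_initial_le) (use e w \<pi> dn in \<open>simp_all add: w_def\<close>)
  with c(2) have "defect G T sides c \<le> failure_bound (real n)" by simp
  moreover obtain Q where Q: "is_coupling Q (binomial_subset G q) (binomial_subset T \<pi>)"
      "1 - defect G T sides c \<le> measure_pmf.prob Q {(E, F). F \<subseteq> T \<and> (\<forall>t\<in>F. sides t \<subseteq> E)}"
    using pmf_of_mass_coupling[OF finite_G finite_T q(1,2) \<pi>(1) \<pi>1 c(1), of sides] by auto
  moreover have "measure_pmf.prob Q {(E, F). F \<subseteq> T \<and> (\<forall>t\<in>F. sides t \<subseteq> E)}
      \<le> measure_pmf.prob Q {(E, F). \<forall>h\<in>F. h \<in> K3_hypergraph E}"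
    by (rule measure_pmf.finite_measure_mono) (auto simp: T_def intro: K3_hypergraph_mem)
  ultimately have "1 - failure_bound (real n)
      \<le> measure_pmf.prob Q {(E, F). \<forall>h\<in>F. h \<in> K3_hypergraph E}" by linarith
  with Q(1) show ?thesis unfolding T_def \<pi>_def by blast
qed

theorem lemma5p2:
  fixes \<epsilon> C :: real
  assumes "0 < \<epsilon>" "\<epsilon> \<le> 1" "0 < C" "C \<le> 1"
  shows "\<exists>d0 :: nat. \<forall>(a :: real) (d :: nat \<Rightarrow> nat) (p :: nat \<Rightarrow> nat \<Rightarrow> real).
    0 < a \<longrightarrow> a < 1 / 2 ^ 10 \<longrightarrow>
    (\<forall>n\<ge>1. 1 \<le> d n \<and> d n \<le> n) \<longrightarrow>
    (\<lambda>n. real n powr (2 / 3) * ln (real n) / real (d n)) \<longlonglongrightarrow> 0 \<longrightarrow>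
    (\<forall>n\<ge>1. 0 \<le> p n (d n) \<and> p n (d n) \<le> 1 \<and>
        p n (d n) \<le> C * (real n * ln (real n)) powr (1 / 3) / real (d n)) \<longrightarrow>
    (\<exists>\<eta> :: nat \<Rightarrow> real. \<eta> \<longlonglongrightarrow> 0 \<and>
      (\<forall>n (lam :: real) G.
        1 \<le> n \<longrightarrow> d0 \<le> d n \<longrightarrow> lam \<le> \<epsilon> * real (d n) \<longrightarrow> ndl_graph n (d n) lam G \<longrightarrow>
        (\<exists>Q :: (edge_set \<times> edge_set) pmf.
          is_coupling Q
            (map_pmf (\<lambda>E. G \<inter> E) (binomial_graph n (p n (d n))))
            (map_pmf (\<lambda>F. K3_hypergraph G \<inter> F) (binomial_hypergraph3 n (a * p n (d n) ^ 3))) \<and>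
          measure_pmf.prob Q {(E, F). \<forall>h\<in>F. h \<in> K3_hypergraph E} \<ge> 1 - \<eta> n)))"
proof (intro exI[of _ 0] allI impI)
  fix a :: real and d :: "nat \<Rightarrow> nat" and p :: "nat \<Rightarrow> nat \<Rightarrow> real"
  assume a: "0 < a" "a < 1 / 2 ^ 10" and d: "\<forall>n\<ge>1. 1 \<le> d n \<and> d n \<le> n"
    and lim: "(\<lambda>n. real n powr (2 / 3) * ln (real n) / real (d n)) \<longlonglongrightarrow> 0"
    and p: "\<forall>n\<ge>1. 0 \<le> p n (d n) \<and> p n (d n) \<le> 1 \<and>
        p n (d n) \<le> C * (real n * ln (real n)) powr (1 / 3) / real (d n)"
  define dense where "dense n \<longleftrightarrow> 3 \<le> n \<and> 120 * (real n powr (1 / 3))\<^sup>2 * ln (real n) \<le> real (d n)" for n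
  \<comment> \<open>The value 1 asks nothing of the probability, so the independent coupling serves
    when \<open>dense n\<close> fails. By the limit hypothesis this happens for finitely many
    \<open>n\<close> only, and \<open>\<eta>\<close> still tends to 0.\<close>
  define \<eta> where "\<eta> n = (if dense n then failure_bound (real n) else 1)" for n
  have "\<forall>\<^sub>F n in sequentially. real n powr (2 / 3) * ln (real n) / real (d n) < 1 / 120"
    using lim by (rule order_tendstoD) simp
  then have "\<forall>\<^sub>F n in sequentially. dense n"
    using eventually_ge_at_top[of 3]
  proof eventually_elim
    case (elim n)
    have "0 < real (d n)" using d elim by (simp add: Suc_le_eq)
    moreover have "(real n powr (1 / 3))\<^sup>2 = real n powr (2 / 3)"
      by (simp add: power2_eq_square powr_add[symmetric])
    ultimately show ?case using elim by (simp add: dense_def field_simps)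
  qed
  then have "\<forall>\<^sub>F n in sequentially. failure_bound (real n) = \<eta> n"
    by eventually_elim (simp add: \<eta>_def)
  with failure_bound_tendsto have \<eta>: "\<eta> \<longlonglongrightarrow> 0" by (rule Lim_transform_eventually)
  have "\<exists>Q. is_coupling Q (map_pmf (\<lambda>E. G \<inter> E) (binomial_graph n (p n (d n))))
      (map_pmf (\<lambda>F. K3_hypergraph G \<inter> F) (binomial_hypergraph3 n (a * p n (d n) ^ 3))) \<and>
    measure_pmf.prob Q {(E, F). \<forall>h\<in>F. h \<in> K3_hypergraph E} \<ge> 1 - \<eta> n"
    if n: "1 \<le> n" and G: "ndl_graph n (d n) lam G" for n lam G
  proof (cases "dense n")
    case False
    then show ?thesis
      by (intro exI[of _ "pair_pmf (map_pmf (\<lambda>E. G \<inter> E) (binomial_graph n (p n (d n))))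
          (map_pmf (\<lambda>F. K3_hypergraph G \<inter> F) (binomial_hypergraph3 n (a * p n (d n) ^ 3)))"])
        (simp add: is_coupling_def map_fst_pair_pmf map_snd_pair_pmf \<eta>_def)
  next
    case True
    have reg: "regular_graph n (d n) G" using G by (simp add: ndl_graph_def)
    then have "G \<subseteq> all_subsets n 2" by (simp add: regular_graph_def)
    then have g: "map_pmf (\<lambda>E. G \<inter> E) (binomial_graph n q) = binomial_subset G q" for q
      unfolding binomial_graph_def by (intro binomial_subset_restrict finite_all_subsets)
    interpret exploration n "d n" G 0 0 0 0 by (rule exploration.intro[OF reg])
    have "K3_hypergraph G \<subseteq> all_subsets n 3"
      using triangle(1,4) by (auto simp: T_def all_subsets_def)
    then have k: "map_pmf (\<lambda>F. K3_hypergraph G \<inter> F) (binomial_hypergraph3 n q)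
        = binomial_subset (K3_hypergraph G) q" for q
      unfolding binomial_hypergraph3_def by (intro binomial_subset_restrict finite_all_subsets)
    have "C * (real n * ln (real n)) powr (1 / 3) / real (d n)
        \<le> (real n * ln (real n)) powr (1 / 3) / real (d n)"
      using assms by (intro divide_right_mono) (auto simp: mult_left_le_one_le)
    then have "p n (d n) \<le> (real n * ln (real n)) powr (1 / 3) / real (d n)"
      using p n by force
    then have "\<exists>Q. is_coupling Q (binomial_subset G (p n (d n)))
        (binomial_subset (K3_hypergraph G) (a * p n (d n) ^ 3)) \<and>
      measure_pmf.prob Q {(E, F). \<forall>h\<in>F. h \<in> K3_hypergraph E} \<ge> 1 - failure_bound (real n)"
      using True a p d n unfolding dense_def by (intro regular_graph_coupling[OF reg]) auto
    then show ?thesis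
      unfolding g k using True by (simp add: \<eta>_def)
  qed
  with \<eta> show "\<exists>\<eta>. \<eta> \<longlonglongrightarrow> 0 \<and> (\<forall>n lam G. 1 \<le> n \<longrightarrow> 0 \<le> d n \<longrightarrow> lam \<le> \<epsilon> * real (d n) \<longrightarrow>
      ndl_graph n (d n) lam G \<longrightarrow> (\<exists>Q. is_coupling Q
            (map_pmf (\<lambda>E. G \<inter> E) (binomial_graph n (p n (d n))))
            (map_pmf (\<lambda>F. K3_hypergraph G \<inter> F) (binomial_hypergraph3 n (a * p n (d n) ^ 3))) \<and>
          measure_pmf.prob Q {(E, F). \<forall>h\<in>F. h \<in> K3_hypergraph E} \<ge> 1 - \<eta> n))"
    by blast
qed

end
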